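(* If a cylindrical graph $G$ has a (cylindrical) rectangular dual, then $G$ is a properly triangulated cylindrical (PTC) graph.
   Context: Graphs are finite and connected; loops and parallel edges are allowed. A cylindrical graph is a graph embedded without crossings on the cylinder; it has two (unbounded) outer faces, which are part of the input; all other faces are inner faces. A chord of a face $f$ is an edge not on $f$ with both endpoints on $f$ (in particular a loop at a vertex of $f$ that is not itself on the boundary of $f$ is a chord of $f$). A separating triangle is a triangle that is not the boundary of a face; it may also consist of a pair of parallel edges between vertices $x,y$ together with a loop at $x$. Loops, parallel edges and triangles are called (non-)contractible according to the closed curve they form on the cylinder. A graph $G$ is a properly triangulated cylindrical (PTC) graph if it is cylindrical, internally triangulated (all inner faces are triangles), all loops, parallel edges and separating triangles are non-contractible, the outer faces have no non-consecutive occurrences of a vertex and no chord, and every vertex $u$ that has parallel edges to a neighbor that has a loop satisfies the following: if $u$ is on an outer face then $\deg(u)\ge 4$; if $u$ has parallel edges to two neighbors that have loops then $\deg(u)\ge 6$; otherwise $\deg(u)\ge 5$. A flat cylinder is a parallelogram $Q$ whose left and right sides are identified. A cylindrical rectangular dual of $G$ is a contact representation of $G$ on a flat cylinder $Q$: each vertex $v$ is mapped to a non-empty axis-aligned rectangle $\mathcal{R}(v)$ (which may extend across the identified sides), rectangles are interior-disjoint, the edges of $G$ (with its embedding) correspond to the contacts (shared boundary segments) between rectangles (loops and parallel edges arise from contacts around the cylinder), such that (i) no four rectangles share a point and (ii) the union of the rectangles forms a strip from the left to the right side of $Q$, that is, an area bounded by two parallel lines.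
   Formalization: "No four rectangles share a point" is counted with multiplicity: a rectangle wrapping around the cylinder counts twice at its seam. Otherwise two stacked rings with aligned seams would be a dual whose graph has an inner face of length 4. *)

theory Defs
  imports "HOL-Analysis.Analysis" "HOL-Combinatorics.Orbits" "Graph_Theory.Graph_Theory"
begin

section \<open>Graphs embedded on the cylinder\<close>

text \<open>
  A multigraph is a symmetric digraph with an involution \<open>arev\<close>: an undirected edge is a pair
  \<open>{a, arev a}\<close> of arcs, also if it is a loop. Hence the degree of a vertex (loops counted
  twice) is its out-degree.

  An embedding without crossings on the cylinder, that is, on the sphere with two points removed,
  is given as a combinatorial map of genus 0 together with the two faces that contain the
  removed points. The map \<open>rot\<close> sends every arc to the clockwise next arc with the same tail.
  Faces are then the orbits of \<open>rot \<circ> arev\<close>; an arc belongs to the face on its left.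
\<close>

locale cylindrical_graph = bidirected_digraph G arev + fin_digraph G
  for G :: "('v, 'a) pre_digraph" and arev :: "'a \<Rightarrow> 'a" +
  fixes rot :: "'a \<Rightarrow> 'a"
    and outer :: "'a set set"
  assumes connected: "connected G"
    and rot_cyclic: "\<And>v. v \<in> verts G \<Longrightarrow> out_arcs G v \<noteq> {} \<Longrightarrow> cyclic_on rot (out_arcs G v)"
    and genus_0: "int (card (verts G)) - int (card (arcs G)) div 2
                    + int (card ((\<lambda>a. orbit (rot \<circ> arev) a) ` arcs G)) = 2"
    and outer_faces: "outer \<subseteq> (\<lambda>a. orbit (rot \<circ> arev) a) ` arcs G"
    and two_outer_faces: "card outer = 2"
begin

definition face_succ :: "'a \<Rightarrow> 'a" where
  "face_succ = rot \<circ> arev"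

definition left_face :: "'a \<Rightarrow> 'a set" where
  "left_face a = orbit face_succ a"

definition faces :: "'a set set" where
  "faces = left_face ` arcs G"

definition inner_faces :: "'a set set" where
  "inner_faces = faces - outer"

definition face_verts :: "'a set \<Rightarrow> 'v set" where
  "face_verts f = tail G ` f"

definition has_loop :: "'v \<Rightarrow> bool" where
  "has_loop v \<longleftrightarrow> (\<exists>a\<in>arcs G. tail G a = v \<and> head G a = v)"

text \<open>Distinct edges with the same ends; the arcs \<open>a\<close> and \<open>b\<close> orient them alike.\<close>

definition parallel :: "'a \<Rightarrow> 'a \<Rightarrow> bool" where
  "parallel a b \<longleftrightarrow> a \<in> arcs G \<and> b \<in> arcs G \<and> b \<noteq> a \<and> b \<noteq> arev a \<and>
     tail G a = tail G b \<and> head G a = head G b"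

definition parallel_neighbor :: "'v \<Rightarrow> 'v \<Rightarrow> bool" where
  "parallel_neighbor u v \<longleftrightarrow>
     u \<noteq> v \<and> (\<exists>a b. parallel a b \<and> tail G a = u \<and> head G a = v)"

text \<open>
  Three distinct edges that form a closed walk. Besides three distinct vertices this allows a loop
  together with a pair of parallel edges.
\<close>

definition triangle :: "'a \<Rightarrow> 'a \<Rightarrow> 'a \<Rightarrow> bool" where
  "triangle a b c \<longleftrightarrow> {a, b, c} \<subseteq> arcs G \<and>
     {a, arev a} \<inter> {b, arev b} = {} \<and> {b, arev b} \<inter> {c, arev c} = {} \<and>
     {c, arev c} \<inter> {a, arev a} = {} \<and>
     head G a = tail G b \<and> head G b = tail G c \<and> head G c = tail G a \<and>
     \<not> (tail G a = tail G b \<and> tail G b = tail G c)"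

definition separating_triangle :: "'a \<Rightarrow> 'a \<Rightarrow> 'a \<Rightarrow> bool" where
  "separating_triangle a b c \<longleftrightarrow>
     triangle a b c \<and> {a, b, c} \<notin> faces \<and> {arev a, arev b, arev c} \<notin> faces"

definition chord :: "'a set \<Rightarrow> 'a \<Rightarrow> bool" where
  "chord f a \<longleftrightarrow> a \<in> arcs G \<and> a \<notin> f \<and> arev a \<notin> f \<and>
     tail G a \<in> face_verts f \<and> head G a \<in> face_verts f"

text \<open>
  Contractibility is homotopy to a constant curve. Since \<open>G\<close> is connected, the inner faces are
  discs, and the cylinder retracts onto the complex formed by \<open>G\<close> and the inner faces. So
  homotopy of closed walks is generated by inserting and deleting an edge traversed
  forth and back, or the boundary walk of an inner face.
\<close>

definition closed_walk :: "'a list \<Rightarrow> bool" where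
  "closed_walk p \<longleftrightarrow> (\<exists>u. awalk u p u)"

definition null_piece :: "'a list \<Rightarrow> bool" where
  "null_piece p \<longleftrightarrow>
     (\<exists>a\<in>arcs G. p = [a, arev a] \<or>
        left_face a \<in> inner_faces \<and>
        p = map (\<lambda>i. (face_succ ^^ i) a) [0..<card (left_face a)])"

definition homotopy_step :: "'a list \<Rightarrow> 'a list \<Rightarrow> bool" where
  "homotopy_step p q \<longleftrightarrow> closed_walk p \<and> closed_walk q \<and>
     (\<exists>xs r ys. null_piece r \<and> p = xs @ ys \<and> q = xs @ r @ ys)"

definition contractible :: "'a list \<Rightarrow> bool" where
  "contractible p \<longleftrightarrow> equivclp homotopy_step p []"

end


section \<open>Properly triangulated cylindrical graphs\<close>

locale PTC_graph = cylindrical_graph +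
  assumes internally_triangulated:
      "\<And>f. f \<in> inner_faces \<Longrightarrow>
         \<exists>a. triangle a (face_succ a) (face_succ (face_succ a)) \<and>
             f = {a, face_succ a, face_succ (face_succ a)}"
    and loops_noncontractible:
      "\<And>a. a \<in> arcs G \<Longrightarrow> tail G a = head G a \<Longrightarrow> \<not> contractible [a]"
    and parallel_noncontractible:
      "\<And>a b. parallel a b \<Longrightarrow> \<not> contractible [a, arev b]"
    and separating_triangles_noncontractible:
      "\<And>a b c. separating_triangle a b c \<Longrightarrow> \<not> contractible [a, b, c]"
    and outer_no_nonconsecutive_occurrences:
      "\<And>f a b. f \<in> outer \<Longrightarrow> a \<in> f \<Longrightarrow> b \<in> f \<Longrightarrow> tail G a = tail G b \<Longrightarrow>
         b = a \<or> b = face_succ a \<or> a = face_succ b"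
    and outer_no_chord:
      "\<And>f a. f \<in> outer \<Longrightarrow> \<not> chord f a"
    and degree_outer:
      "\<And>u v f. parallel_neighbor u v \<Longrightarrow> has_loop v \<Longrightarrow> f \<in> outer \<Longrightarrow> u \<in> face_verts f \<Longrightarrow>
         out_degree G u \<ge> 4"
    and degree_two_looped_neighbors:
      "\<And>u v w. parallel_neighbor u v \<Longrightarrow> has_loop v \<Longrightarrow> parallel_neighbor u w \<Longrightarrow> has_loop w \<Longrightarrow>
         v \<noteq> w \<Longrightarrow> out_degree G u \<ge> 6"
    and degree_otherwise:
      "\<And>u v. parallel_neighbor u v \<Longrightarrow> has_loop v \<Longrightarrow>
         (\<And>f. f \<in> outer \<Longrightarrow> u \<notin> face_verts f) \<Longrightarrow>
         (\<And>w. parallel_neighbor u w \<Longrightarrow> has_loop w \<Longrightarrow> w = v) \<Longrightarrow> out_degree G u \<ge> 5"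


section \<open>Cylindrical rectangular duals\<close>

text \<open>
  Identifying the left and right sides of a parallelogram yields (a part of) the quotient of the
  plane by a translation \<open>t\<close>, where \<open>t\<close> is the vector along the top and bottom
  sides; \<open>t\<close> need not be horizontal. We work in the plane, with all translates of each
  rectangle by integer multiples of \<open>t\<close>.
\<close>

type_synonym rect = "(real \<times> real) \<times> (real \<times> real)"

text \<open>A rectangle is given by its lower left and upper right corners.\<close>

definition proper_rect :: "rect \<Rightarrow> bool" where
  "proper_rect r \<longleftrightarrow> fst (fst r) < fst (snd r) \<and> snd (fst r) < snd (snd r)"

definition region :: "rect \<Rightarrow> (real \<times> real) set" where
  "region r = cbox (fst r) (snd r)"

definition translate :: "real \<times> real \<Rightarrow> rect \<Rightarrow> rect" where
  "translate w r = (fst r + w, snd r + w)"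

definition touch :: "rect \<Rightarrow> rect \<Rightarrow> bool" where
  "touch r s \<longleftrightarrow> (\<exists>p q. p \<noteq> q \<and> closed_segment p q \<subseteq> region r \<inter> region s)"

text \<open>
  The end of the contact segment of \<open>r\<close> and \<open>s\<close> that lies on the left when crossing it
  from \<open>r\<close> to \<open>s\<close>, which is also its first point clockwise around \<open>r\<close>. It is the lower
  or left end if \<open>s\<close> lies above or to the left of \<open>r\<close>, and the upper or right end otherwise.
\<close>

definition left_end :: "rect \<Rightarrow> rect \<Rightarrow> real \<times> real" where
  "left_end r s =
     (if snd (fst s) = snd (snd r) \<or> fst (snd s) = fst (fst r)
      then (max (fst (fst r)) (fst (fst s)), max (snd (fst r)) (snd (fst s)))
      else (min (fst (snd r)) (fst (snd s)), min (snd (snd r)) (snd (snd s))))"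

definition width :: "rect \<Rightarrow> real" where
  "width r = fst (snd r) - fst (fst r)"

definition height :: "rect \<Rightarrow> real" where
  "height r = snd (snd r) - snd (fst r)"

text \<open>Length of the boundary of \<open>r\<close> clockwise from the upper left corner to the boundary point \<open>p\<close>.\<close>

definition cw_pos :: "rect \<Rightarrow> real \<times> real \<Rightarrow> real" where
  "cw_pos r p =
     (if snd p = snd (snd r) \<and> fst p < fst (snd r) then fst p - fst (fst r)
      else if fst p = fst (snd r) \<and> snd p > snd (fst r) then width r + (snd (snd r) - snd p)
      else if snd p = snd (fst r) \<and> fst p > fst (fst r)
        then width r + height r + (fst (snd r) - fst p)
      else 2 * width r + height r + (snd p - snd (fst r)))"

text \<open>Clockwise distance from \<open>p\<close> to \<open>q\<close> along the boundary, a full turn if \<open>p = q\<close>.\<close>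

definition cw_dist :: "rect \<Rightarrow> real \<times> real \<Rightarrow> real \<times> real \<Rightarrow> real" where
  "cw_dist r p q =
     (if cw_pos r p < cw_pos r q then cw_pos r q - cw_pos r p
      else cw_pos r q - cw_pos r p + 2 * (width r + height r))"

context cylindrical_graph
begin

text \<open>
  The arc \<open>a\<close> from \<open>u\<close> to \<open>v\<close> is drawn through the contact of \<open>R u\<close> with the translate of
  \<open>R v\<close> by \<open>lift a\<close> times \<open>t\<close>. Distinct contacts, even between the same two rectangles
  of the cylinder, belong to distinct triples \<open>(u, v, k)\<close>, because the intersection
  of two rectangles in the plane is convex.
\<close>

definition rectangular_dual ::
  "real \<times> real \<Rightarrow> ('v \<Rightarrow> rect) \<Rightarrow> ('a \<Rightarrow> int) \<Rightarrow> bool" where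
  "rectangular_dual t R lift \<longleftrightarrow>
     (let
        tile = (\<lambda>v (k::int). translate (of_int k *\<^sub>R t) (R v));
        union = (\<Union>v\<in>verts G. \<Union>k. region (tile v k));
        lend = (\<lambda>a. left_end (R (tail G a)) (tile (head G a) (lift a)))
      in
        fst t > 0 \<and>
        (\<forall>v\<in>verts G. proper_rect (R v)) \<and>
        (\<forall>u\<in>verts G. \<forall>v\<in>verts G. \<forall>j k. (u, j) \<noteq> (v, k) \<longrightarrow>
           interior (region (tile u j)) \<inter> interior (region (tile v k)) = {}) \<and>
        \<comment> \<open>no four rectangles share a point; a rectangle counts as often as it reaches the point\<close>
        (\<forall>p. \<nexists>S. S \<subseteq> {(v, k). v \<in> verts G \<and> p \<in> region (tile v k)} \<and> card S = 4) \<and>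
        \<comment> \<open>the union is a strip; its bounding lines close up on the cylinder, so are parallel to \<open>t\<close>\<close>
        (\<exists>c d. union = {p. c \<le> fst t * snd p - snd t * fst p \<and> fst t * snd p - snd t * fst p \<le> d}) \<and>
        \<comment> \<open>edges correspond to contacts\<close>
        bij_betw (\<lambda>a. (tail G a, head G a, lift a)) (arcs G)
          {(u, v, k). u \<in> verts G \<and> v \<in> verts G \<and> (u, 0) \<noteq> (v, k) \<and> touch (R u) (tile v k)} \<and>
        (\<forall>a\<in>arcs G. lift (arev a) = - lift a) \<and>
        \<comment> \<open>the rotation at a vertex is the clockwise order of the contacts around its rectangle\<close>
        (\<forall>a\<in>arcs G. \<forall>b\<in>out_arcs G (tail G a).
           cw_dist (R (tail G a)) (lend a) (lend (rot a)) \<le> cw_dist (R (tail G a)) (lend a) (lend b)) \<and>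
        \<comment> \<open>the outer faces correspond to the two sides of the complement of the strip\<close>
        (\<forall>a\<in>arcs G. left_face a \<in> outer \<longleftrightarrow> lend a \<in> frontier union))"

definition has_rectangular_dual :: bool where
  "has_rectangular_dual \<longleftrightarrow> (\<exists>t R lift. rectangular_dual t R lift)"

end

end

theory Submission
  imports Defs
begin

text \<open>
  The bounding lines of the strip are horizontal: a slanted line of slope \<open>snd t / fst t\<close> bounding
  the union would meet every rectangle in at most one corner, but there are only countably many
  rectangles. So the rectangles lift to a periodic tiling of a horizontal strip in the plane.

  At an interior corner of the tiling exactly three tiles meet, and since the rotation system is the
  clockwise order of contacts, their three contacts form an orbit of the face successor. Hence inner
  faces are triangles whose lifts sum to zero, so the sum of lifts is a homotopy invariant. It is
  nonzero for loops and pairs of parallel edges; and if it vanishes for a triangle, the three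
  rectangles lift to pairwise touching boxes, which have a common point (Helly's theorem for boxes),
  so the triangle is an inner face.

  The rectangles along the top (bottom) of the strip form one cycle that bounds an outer face. For
  the degree conditions, a rectangle with a loop spans the whole cylinder, so the rectangle of a
  neighbor joined to it by parallel edges has two contacts on one horizontal side, besides at least
  one contact on its left and on its right side, and at least one on its other horizontal side unless
  that side is on the boundary of the strip.
\<close>

section \<open>Contacts between rectangles\<close>

abbreviation xl :: "rect \<Rightarrow> real" where "xl r \<equiv> fst (fst r)"
abbreviation xr :: "rect \<Rightarrow> real" where "xr r \<equiv> fst (snd r)"
abbreviation yb :: "rect \<Rightarrow> real" where "yb r \<equiv> snd (fst r)"
abbreviation yt :: "rect \<Rightarrow> real" where "yt r \<equiv> snd (snd r)"

text \<open>For proper rectangles this is disjointness of the interiors, in a form made of linear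
  inequalities only.\<close>

definition separated :: "rect \<Rightarrow> rect \<Rightarrow> bool" where
  "separated r s \<longleftrightarrow> xr r \<le> xl s \<or> xr s \<le> xl r \<or> yt r \<le> yb s \<or> yt s \<le> yb r"

text \<open>Directed: \<open>s\<close> rests on the upper side of \<open>r\<close>; in
  \<open>beside\<close> it adjoins the right side. The strict inequalities demand a contact of
  positive length, so meeting in a corner does not count.\<close>

definition stacked :: "rect \<Rightarrow> rect \<Rightarrow> bool" where
  "stacked r s \<longleftrightarrow> yb s = yt r \<and> xl r < xr s \<and> xl s < xr r"

definition beside :: "rect \<Rightarrow> rect \<Rightarrow> bool" where
  "beside r s \<longleftrightarrow> xl s = xr r \<and> yb r < yt s \<and> yb s < yt r"

lemma mem_region: "p \<in> region r \<longleftrightarrow> xl r \<le> fst p \<and> fst p \<le> xr r \<and> yb r \<le> snd p \<and> snd p \<le> yt r"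
  by (cases r; cases p) (auto simp: region_def cbox_Pair_eq mem_Times_iff)

lemma mem_interior_region:
  "p \<in> interior (region r) \<longleftrightarrow> xl r < fst p \<and> fst p < xr r \<and> yb r < snd p \<and> snd p < yt r"
  by (cases r; cases p) (auto simp: region_def interior_cbox mem_box Basis_prod_def)

lemma separated_iff:
  assumes "proper_rect r" "proper_rect s"
  shows "interior (region r) \<inter> interior (region s) = {} \<longleftrightarrow> separated r s"
proof
  \<comment> \<open>The centre of the intersection box; unless the rectangles are separated it is
    interior to both.\<close>
  define m where "m = ((max (xl r) (xl s) + min (xr r) (xr s)) / 2, (max (yb r) (yb s) + min (yt r) (yt s)) / 2)"
  assume "interior (region r) \<inter> interior (region s) = {}"
  then have "m \<notin> interior (region r) \<inter> interior (region s)" by simp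
  then show "separated r s"
    using assms unfolding separated_def mem_interior_region m_def proper_rect_def Int_iff
    by (simp add: field_simps max_def min_def split: if_splits) argo+
qed (auto simp: separated_def mem_interior_region)

lemma separated_sym: "separated r s \<longleftrightarrow> separated s r"
  unfolding separated_def by auto

text \<open>By separation the common part of the rectangles has no interior, so two distinct common
  points force positive extent in exactly one direction.\<close>

lemma touch_iff:
  assumes "proper_rect r" "proper_rect s" "separated r s"
  shows "touch r s \<longleftrightarrow> stacked r s \<or> stacked s r \<or> beside r s \<or> beside s r"
proof
  assume "touch r s"
  then obtain p q where "p \<noteq> q" "p \<in> region r \<inter> region s" "q \<in> region r \<inter> region s"
    unfolding touch_def by blast
  then show "stacked r s \<or> stacked s r \<or> beside r s \<or> beside s r"
    using assms unfolding stacked_def beside_def mem_region separated_def proper_rect_def Int_iff prod_eq_iff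
    by argo
next
  \<comment> \<open>The lower left and upper right corners of the intersection box span the segment,
    since the intersection is convex.\<close>
  have *: "touch r s"
    if "max (xl r) (xl s) \<le> min (xr r) (xr s)" "max (yb r) (yb s) \<le> min (yt r) (yt s)"
      "max (xl r) (xl s) \<noteq> min (xr r) (xr s) \<or> max (yb r) (yb s) \<noteq> min (yt r) (yt s)"
    unfolding touch_def
  proof (intro exI conjI)
    let ?p = "(max (xl r) (xl s), max (yb r) (yb s))" and ?q = "(min (xr r) (xr s), min (yt r) (yt s))"
    show "?p \<noteq> ?q" using that(3) by simp
    have "convex (region r \<inter> region s)" by (simp add: region_def convex_Int convex_box)
    moreover have "?p \<in> region r \<inter> region s" "?q \<in> region r \<inter> region s"
      using that(1,2) by (auto simp: mem_region)
    ultimately show "closed_segment ?p ?q \<subseteq> region r \<inter> region s"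
      by (intro closed_segment_subset)
  qed
  assume "stacked r s \<or> stacked s r \<or> beside r s \<or> beside s r"
  then show "touch r s"
    using assms(1,2) unfolding stacked_def beside_def proper_rect_def
    by (intro *) auto
qed

section \<open>Ends of contacts in clockwise order\<close>

lemma left_end_above: "proper_rect r \<Longrightarrow> proper_rect s \<Longrightarrow> stacked r s \<Longrightarrow> left_end r s = (max (xl r) (xl s), yt r)"
  and left_end_below: "proper_rect r \<Longrightarrow> proper_rect s \<Longrightarrow> stacked s r \<Longrightarrow> left_end r s = (min (xr r) (xr s), yb r)"
  and left_end_right: "proper_rect r \<Longrightarrow> proper_rect s \<Longrightarrow> beside r s \<Longrightarrow> left_end r s = (xr r, min (yt r) (yt s))"
  and left_end_left: "proper_rect r \<Longrightarrow> proper_rect s \<Longrightarrow> beside s r \<Longrightarrow> left_end r s = (xl r, max (yb r) (yb s))"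
  unfolding left_end_def stacked_def beside_def proper_rect_def by (auto simp: max_def min_def)

lemmas left_end_simps = left_end_above left_end_below left_end_right left_end_left

text \<open>The left end is the clockwise first point of the contact, so it is never the final
  corner of its side, which \<open>cw_pos\<close> assigns to the next side.\<close>

lemma cw_pos_above: "proper_rect r \<Longrightarrow> proper_rect s \<Longrightarrow> stacked r s \<Longrightarrow>
    cw_pos r (left_end r s) = max (xl r) (xl s) - xl r"
  and cw_pos_right: "proper_rect r \<Longrightarrow> proper_rect s \<Longrightarrow> beside r s \<Longrightarrow>
    cw_pos r (left_end r s) = width r + (yt r - min (yt r) (yt s))"
  and cw_pos_below: "proper_rect r \<Longrightarrow> proper_rect s \<Longrightarrow> stacked s r \<Longrightarrow>
    cw_pos r (left_end r s) = width r + height r + (xr r - min (xr r) (xr s))"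
  and cw_pos_left: "proper_rect r \<Longrightarrow> proper_rect s \<Longrightarrow> beside s r \<Longrightarrow>
    cw_pos r (left_end r s) = 2 * width r + height r + (max (yb r) (yb s) - yb r)"
  by (auto simp: left_end_simps cw_pos_def stacked_def beside_def proper_rect_def width_def height_def max_def min_def)

lemmas cw_pos_simps = cw_pos_above cw_pos_right cw_pos_below cw_pos_left

text \<open>Seen from \<open>r\<close>, the point \<open>left_end s r\<close> is the right end of the contact segment.\<close>

lemma cw_pos_end_above: "proper_rect r \<Longrightarrow> proper_rect s \<Longrightarrow> stacked r s \<Longrightarrow>
    cw_pos r (left_end s r) = min (xr r) (xr s) - xl r"
  and cw_pos_end_right: "proper_rect r \<Longrightarrow> proper_rect s \<Longrightarrow> beside r s \<Longrightarrow>
    cw_pos r (left_end s r) = width r + (yt r - max (yb r) (yb s))"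
  and cw_pos_end_below: "proper_rect r \<Longrightarrow> proper_rect s \<Longrightarrow> stacked s r \<Longrightarrow>
    cw_pos r (left_end s r) = width r + height r + (xr r - max (xl r) (xl s))"
  and cw_pos_end_left: "proper_rect r \<Longrightarrow> proper_rect s \<Longrightarrow> beside s r \<Longrightarrow>
    cw_pos r (left_end s r) = (if yt r \<le> yt s then 0 else 2 * width r + height r + (yt s - yb r))"
  by (auto simp: left_end_simps cw_pos_def stacked_def beside_def proper_rect_def width_def height_def max_def min_def)

lemmas cw_pos_end_simps = cw_pos_end_above cw_pos_end_right cw_pos_end_below cw_pos_end_left

text \<open>Two contacts that start at the same point run along the same side of \<open>r\<close>,
  so just after that point \<open>s\<close> and \<open>s'\<close> overlap outside
  \<open>r\<close>.\<close>

lemma cw_pos_inj: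
  assumes "proper_rect r" "proper_rect s" "proper_rect s'" "separated r s" "separated r s'"
    and "touch r s" "touch r s'" "cw_pos r (left_end r s) = cw_pos r (left_end r s')"
  shows "\<not> separated s s'"
proof -
  have *: "width r > 0" "height r > 0" using assms(1) by (auto simp: proper_rect_def width_def height_def)
  have "(stacked r s \<or> stacked s r \<or> beside r s \<or> beside s r)" "(stacked r s' \<or> stacked s' r \<or> beside r s' \<or> beside s' r)"
    using assms touch_iff by blast+
  then show ?thesis
    using assms(1,2,3,8)
    by (elim disjE; simp add: cw_pos_simps; simp add: stacked_def beside_def separated_def proper_rect_def width_def height_def max_def min_def split: if_splits; linarith?)
qed

lemma touch_cases:
  assumes "proper_rect r" "proper_rect s" "separated r s" "touch r s"
  obtains "stacked r s" | "stacked s r" | "beside r s" | "beside s r"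
  using assms touch_iff by blast

lemma cw_pos_range:
  assumes "proper_rect r" "proper_rect s" "separated r s" "touch r s"
  shows "0 \<le> cw_pos r (left_end r s)" "cw_pos r (left_end r s) < 2 * (width r + height r)"
  by (rule touch_cases[OF assms]; use assms(1,2) in \<open>simp add: cw_pos_simps\<close>;
      use assms(1,2) in \<open>auto simp: stacked_def beside_def proper_rect_def width_def height_def max_def min_def\<close>)+

text \<open>Both positions lie within one perimeter, so the two branches of \<open>cw_dist\<close>
  cannot produce the same value.\<close>

lemma cw_dist_inj:
  assumes "proper_rect r" "proper_rect s" "proper_rect s'" "separated r s" "separated r s'"
    and "touch r s" "touch r s'" "cw_dist r q (left_end r s) = cw_dist r q (left_end r s')"
  shows "cw_pos r (left_end r s) = cw_pos r (left_end r s')"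
  using cw_pos_range[OF assms(1,2,4,6)] cw_pos_range[OF assms(1,3,5,7)] assms(8)
  unfolding cw_dist_def by (simp split: if_splits)

text \<open>The contact with \<open>s\<close> fills the clockwise stretch between its ends, so no
  other contact starts before its final point; for \<open>s' = s\<close> the right-hand side is a
  full turn.\<close>

lemma cw_dist_contact_end:
  assumes "proper_rect r" "proper_rect s" "proper_rect s'" "separated r s" "separated r s'"
    and "touch r s" "touch r s'" "s = s' \<or> separated s s'"
  shows "cw_dist r (left_end r s) (left_end s r) \<le> cw_dist r (left_end r s) (left_end r s')"
  by (rule touch_cases[OF assms(1,2,4,6)]; rule touch_cases[OF assms(1,3,5,7)];
      use assms(1-3,8) in \<open>simp add: cw_dist_def cw_pos_simps cw_pos_end_simps\<close>;
      use assms(1-3,8) in \<open>auto simp: stacked_def beside_def separated_def proper_rect_def width_def height_def max_def min_def\<close>)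

text \<open>Here \<open>s\<close> covers the left side of \<open>r\<close> up to the corner, nothing
  lies on the upper side, and the contact with \<open>m\<close> starts at the upper right corner. So
  \<open>m\<close> comes next clockwise after \<open>s\<close>.\<close>

lemma cw_dist_top:
  assumes "proper_rect r" "proper_rect s" "proper_rect s'" "proper_rect m" "separated r s" "separated r s'"
    and "beside s r" "beside r m" "touch r s'" "s = s' \<or> separated s s'"
    and "yt r \<le> yt s" "yt r \<le> yt m" "\<not> stacked r s'"
  shows "cw_dist r (left_end r s) (left_end r m) \<le> cw_dist r (left_end r s) (left_end r s')"
  by (rule touch_cases[OF assms(1,3,6,9)];
      use assms(1-4,7-) in \<open>simp add: cw_dist_def cw_pos_simps\<close>;
      use assms(1-4,7-) in \<open>auto simp: stacked_def beside_def separated_def proper_rect_def width_def height_def max_def min_def\<close>)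

text \<open>The image of \<open>cw_dist_top\<close> under a half-turn.\<close>

lemma cw_dist_bottom:
  assumes "proper_rect r" "proper_rect s" "proper_rect s'" "proper_rect m" "separated r s" "separated r s'"
    and "beside r s" "beside m r" "touch r s'" "s = s' \<or> separated s s'"
    and "yb s \<le> yb r" "yb m \<le> yb r" "\<not> stacked s' r"
  shows "cw_dist r (left_end r s) (left_end r m) \<le> cw_dist r (left_end r s) (left_end r s')"
  by (rule touch_cases[OF assms(1,3,6,9)];
      use assms(1-4,7-) in \<open>simp add: cw_dist_def cw_pos_simps\<close>;
      use assms(1-4,7-) in \<open>auto simp: stacked_def beside_def separated_def proper_rect_def width_def height_def max_def min_def\<close>)

section \<open>Quadrants at a point\<close>

text \<open>
  The rectangle \<open>r\<close> covers a germ of quadrant number \<open>d\<close> at \<open>p\<close>, counting counterclockwise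
  from the upper right one modulo 4. A contact \<open>left_end r s = p\<close> is then a change from \<open>r\<close> to \<open>s\<close> between
  successive quadrants, whatever the side of the contact.
\<close>

definition quad :: "nat \<Rightarrow> rect \<Rightarrow> real \<times> real \<Rightarrow> bool" where
  "quad d r p \<longleftrightarrow>
     (if d mod 4 \<in> {0, 3} then xl r \<le> fst p \<and> fst p < xr r else xl r < fst p \<and> fst p \<le> xr r) \<and>
     (if d mod 4 \<in> {0, 1} then yb r \<le> snd p \<and> snd p < yt r else yb r < snd p \<and> snd p \<le> yt r)"

lemma mod_4_cases:
  fixes d :: nat
  obtains "d mod 4 = 0" "Suc d mod 4 = 1" "(d + 2) mod 4 = 2" "(d + 3) mod 4 = 3"
  | "d mod 4 = 1" "Suc d mod 4 = 2" "(d + 2) mod 4 = 3" "(d + 3) mod 4 = 0"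
  | "d mod 4 = 2" "Suc d mod 4 = 3" "(d + 2) mod 4 = 0" "(d + 3) mod 4 = 1"
  | "d mod 4 = 3" "Suc d mod 4 = 0" "(d + 2) mod 4 = 1" "(d + 3) mod 4 = 2"
proof -
  have "d mod 4 = 0 \<or> d mod 4 = 1 \<or> d mod 4 = 2 \<or> d mod 4 = 3" by presburger
  then show ?thesis
    using that by (elim disjE) (simp_all add: mod_Suc mod_add_left_eq[of d 4, symmetric])
qed

lemma quad_mem: "quad d r p \<Longrightarrow> p \<in> region r"
  unfolding quad_def mem_region by (auto split: if_splits)

lemma quad_unique: "quad d r p \<Longrightarrow> quad d s p \<Longrightarrow> \<not> separated r s"
  unfolding quad_def separated_def by (auto split: if_splits)

text \<open>Covering two opposite quadrants makes all four inequalities strict, so \<open>p\<close>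
  is an interior point of \<open>r\<close>.\<close>

lemma quad_opposite: "quad d r p \<Longrightarrow> quad (d + 2) r p \<Longrightarrow> quad e r p"
  by (rule mod_4_cases[of d]) (auto simp: quad_def split: if_splits)

lemma ex_quad: "proper_rect r \<Longrightarrow> p \<in> region r \<Longrightarrow> \<exists>d. quad d r p"
proof -
  assume "proper_rect r" "p \<in> region r"
  then have "quad 0 r p \<or> quad 1 r p \<or> quad 2 r p \<or> quad 3 r p"
    unfolding quad_def mem_region proper_rect_def by auto
  then show ?thesis by blast
qed

text \<open>Crossing from \<open>r\<close> to \<open>s\<close> with \<open>p\<close> on the left is
  a counterclockwise move around \<open>p\<close>. In the excluded configuration the contact line
  would continue through \<open>p\<close>, which would then not be an end of it.\<close>

lemma quad_left_end:
  assumes "proper_rect r" "proper_rect s" "separated r s" "touch r s"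
  shows "\<exists>d. quad d r (left_end r s) \<and> quad (Suc d) s (left_end r s) \<and>
           \<not> (quad (d + 2) s (left_end r s) \<and> quad (d + 3) r (left_end r s))"
  \<comment> \<open>The quadrant of \<open>r\<close> at the left end when \<open>s\<close> lies
    above, below, to the right and to the left.\<close>
  by (rule touch_cases[OF assms], rule_tac [1] exI[of _ 3], rule_tac [2] exI[of _ 1],
      rule_tac [3] exI[of _ 2], rule_tac [4] exI[of _ 0];
      use assms(1,2) in \<open>simp add: left_end_simps quad_def stacked_def beside_def proper_rect_def max_def min_def\<close>)

text \<open>Successive quadrants share a half-axis, and an initial piece of it belongs to both
  rectangles.\<close>

lemma quad_touch:
  assumes "proper_rect r" "proper_rect s" "separated r s" "quad d r p" "quad (Suc d) s p"
  shows "touch r s"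
  unfolding touch_iff[OF assms(1-3)] using assms
  by (rule_tac mod_4_cases[of d]; auto simp: quad_def stacked_def beside_def separated_def proper_rect_def)

text \<open>Converse of \<open>quad_left_end\<close>: a change from \<open>r\<close> to
  \<open>s\<close> at \<open>p\<close> places \<open>p\<close> on the contact, and the last
  assumption prevents \<open>p\<close> from being an inner point of it.\<close>

lemma left_end_eqI:
  assumes "proper_rect r" "proper_rect s" "separated r s" "quad d r p" "quad (Suc d) s p"
    and "\<not> (quad (d + 2) s p \<and> quad (d + 3) r p)"
  shows "left_end r s = p"
  by (rule touch_cases[OF assms(1-3) quad_touch[OF assms(1-5)]]; rule mod_4_cases[of d];
      use assms in \<open>simp add: left_end_simps prod_eq_iff\<close>;
      use assms in \<open>auto simp: quad_def stacked_def beside_def proper_rect_def max_def min_def\<close>)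

section \<open>Tilings of a strip\<close>

lemma mod_4_complete:
  fixes d e :: nat
  shows "d mod 4 = e mod 4 \<or> d mod 4 = Suc e mod 4 \<or> d mod 4 = (e + 2) mod 4 \<or> d mod 4 = (e + 3) mod 4"
  by (rule mod_4_cases[of e]; rule mod_4_cases[of d]; metis)

lemma quad_cong: "d mod 4 = e mod 4 \<Longrightarrow> quad d = quad e"
  unfolding quad_def fun_eq_iff by simp

lemma quad_add_4: "quad (d + 4) = quad d" "quad (Suc (d + 3)) = quad d" "quad (d + 5) = quad (Suc d)"
  by (rule quad_cong, presburger)+

text \<open>Supplies a step so short that it crosses no coordinate other than one it starts
  on.\<close>

lemma ex_less_abs:
  fixes S :: "real set"
  assumes "finite S"
  obtains e where "e > 0" "\<And>s. s \<in> S \<Longrightarrow> s \<noteq> 0 \<Longrightarrow> e < \<bar>s\<bar>"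
proof -
  define m where "m = Min (insert 1 (abs ` (S - {0})))"
  have "m > 0" "\<And>s. s \<in> S \<Longrightarrow> s \<noteq> 0 \<Longrightarrow> m \<le> \<bar>s\<bar>"
    using assms by (auto simp: m_def)
  then have "m / 2 > 0" "\<And>s. s \<in> S \<Longrightarrow> s \<noteq> 0 \<Longrightarrow> m / 2 < \<bar>s\<bar>" by fastforce+
  then show thesis by (rule that)
qed

text \<open>Models the universal cover of the cylinder. There are infinitely many tiles, so
  finiteness is demanded only for those whose horizontal extent meets a bounded interval.\<close>

locale strip_tiling =
  fixes I :: "'i set" and tile :: "'i \<Rightarrow> rect" and B D :: real
  assumes proper: "i \<in> I \<Longrightarrow> proper_rect (tile i)"
    and separated_tiles: "i \<in> I \<Longrightarrow> j \<in> I \<Longrightarrow> i \<noteq> j \<Longrightarrow> separated (tile i) (tile j)"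
    and cover: "(\<Union>i\<in>I. region (tile i)) = {p. B \<le> snd p \<and> snd p \<le> D}"
    and locally_finite: "finite {i \<in> I. xl (tile i) \<le> b \<and> a \<le> xr (tile i)}"
    and no_four: "S \<subseteq> {i \<in> I. p \<in> region (tile i)} \<Longrightarrow> card S \<noteq> 4"
begin

lemma tile_bounds:
  assumes "i \<in> I"
  shows "B \<le> yb (tile i)" "yt (tile i) \<le> D" "yb (tile i) < yt (tile i)" "xl (tile i) < xr (tile i)"
proof -
  show *: "yb (tile i) < yt (tile i)" "xl (tile i) < xr (tile i)"
    using proper[OF assms] by (auto simp: proper_rect_def)
  then have "fst (tile i) \<in> region (tile i)" "snd (tile i) \<in> region (tile i)"
    by (auto simp: mem_region)
  then have "fst (tile i) \<in> {p. B \<le> snd p \<and> snd p \<le> D}" "snd (tile i) \<in> {p. B \<le> snd p \<and> snd p \<le> D}"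
    using assms cover by blast+
  then show "B \<le> yb (tile i)" "yt (tile i) \<le> D" by auto
qed

section \<open>Tiles around a point of the strip\<close>

text \<open>A tile containing a point slightly displaced from \<open>p\<close> into the quadrant
  covers the whole germ, as no border of a nearby tile lies strictly between.\<close>

lemma quad_exists:
  assumes "B \<le> snd p" "snd p \<le> D" "d mod 4 \<in> {0, 1} \<Longrightarrow> snd p < D" "d mod 4 \<in> {2, 3} \<Longrightarrow> B < snd p"
  obtains i where "i \<in> I" "quad d (tile i) p"
proof -
  define F where "F = {i \<in> I. xl (tile i) \<le> fst p + 1 \<and> fst p - 1 \<le> xr (tile i)}"
  \<comment> \<open>Offsets from \<open>p\<close> of the borders of the strip and of all nearby
    tiles; the element 1 keeps the displaced point inside the window that defines
    \<open>F\<close>.\<close>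
  define S where "S = {1, D - snd p, B - snd p} \<union>
    (\<Union>i\<in>F. {xl (tile i) - fst p, xr (tile i) - fst p, yb (tile i) - snd p, yt (tile i) - snd p})"
  have "finite F" unfolding F_def by (rule locally_finite)
  then have "finite S" by (auto simp: S_def)
  then obtain e where e: "e > 0" "\<And>s. s \<in> S \<Longrightarrow> s \<noteq> 0 \<Longrightarrow> e < \<bar>s\<bar>"
    by (rule ex_less_abs) blast
  define q where "q = (fst p + (if d mod 4 \<in> {0, 3} then e else - e), snd p + (if d mod 4 \<in> {0, 1} then e else - e))"
  have "e < 1" "D \<noteq> snd p \<longrightarrow> e < \<bar>D - snd p\<bar>" "B \<noteq> snd p \<longrightarrow> e < \<bar>B - snd p\<bar>"
    using e(2)[of 1] e(2)[of "D - snd p"] e(2)[of "B - snd p"] by (auto simp: S_def)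
  then have "q \<in> {p. B \<le> snd p \<and> snd p \<le> D}"
    using assms \<open>e > 0\<close> by (rule_tac mod_4_cases[of d]; auto simp: q_def)
  then obtain i where i: "i \<in> I" "q \<in> region (tile i)" using cover by blast
  have "i \<in> F" using i \<open>e > 0\<close> \<open>e < 1\<close> by (auto simp: F_def mem_region q_def split: if_splits)
  then have "{xl (tile i) - fst p, xr (tile i) - fst p, yb (tile i) - snd p, yt (tile i) - snd p} \<subseteq> S"
    by (auto simp: S_def)
  then have "xl (tile i) \<noteq> fst p \<longrightarrow> e < \<bar>xl (tile i) - fst p\<bar>" "xr (tile i) \<noteq> fst p \<longrightarrow> e < \<bar>xr (tile i) - fst p\<bar>"
    "yb (tile i) \<noteq> snd p \<longrightarrow> e < \<bar>yb (tile i) - snd p\<bar>" "yt (tile i) \<noteq> snd p \<longrightarrow> e < \<bar>yt (tile i) - snd p\<bar>"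
    using e(2) by auto
  then have "quad d (tile i) p"
    using i(2) \<open>e > 0\<close> unfolding quad_def q_def mem_region by (auto split: if_splits)
  then show thesis using that i(1) by blast
qed

lemma quad_eq: "i \<in> I \<Longrightarrow> j \<in> I \<Longrightarrow> quad d (tile i) p \<Longrightarrow> quad d (tile j) p \<Longrightarrow> i = j"
  using quad_unique separated_tiles by blast

lemma contact_quad:
  assumes "i \<in> I" "j \<in> I" "i \<noteq> j" "touch (tile i) (tile j)" "left_end (tile i) (tile j) = p"
  obtains d where "quad d (tile i) p" "quad (Suc d) (tile j) p"
    "\<not> (quad (d + 2) (tile j) p \<and> quad (d + 3) (tile i) p)"
  using quad_left_end[of "tile i" "tile j"] assms proper separated_tiles by metis

lemma quad_contact:
  assumes "i \<in> I" "j \<in> I" "i \<noteq> j" "quad d (tile i) p" "quad (Suc d) (tile j) p"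
    and "\<not> quad (d + 2) (tile j) p \<or> \<not> quad (d + 3) (tile i) p"
  shows "touch (tile i) (tile j) \<and> left_end (tile i) (tile j) = p"
  using assms proper separated_tiles quad_touch left_end_eqI by metis

lemma not_four_tiles:
  assumes "{i, j, k, l} \<subseteq> I" "p \<in> region (tile i)" "p \<in> region (tile j)" "p \<in> region (tile k)" "p \<in> region (tile l)"
    "i \<noteq> j" "i \<noteq> k" "i \<noteq> l" "j \<noteq> k" "j \<noteq> l"
  shows "k = l"
  using no_four[of "{i, j, k, l}" p] assms by (rule_tac ccontr) auto

text \<open>The tiles in the four quadrants at \<open>p\<close>, counterclockwise, are
  \<open>i\<close>, \<open>j\<close>, \<open>k\<close>, \<open>l\<close>. Exactly one further tile
  occurs among them, and it follows \<open>j\<close> and precedes \<open>i\<close>.\<close>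

lemma third_tile:
  assumes i: "i \<in> I" and j: "j \<in> I" and "i \<noteq> j" "touch (tile i) (tile j)" "left_end (tile i) (tile j) = p"
    and p: "B < snd p" "snd p < D"
  obtains m where "m \<in> I" "m \<noteq> i" "m \<noteq> j"
    "touch (tile j) (tile m)" "left_end (tile j) (tile m) = p"
    "touch (tile m) (tile i)" "left_end (tile m) (tile i) = p"
proof -
  obtain d where d: "quad d (tile i) p" "quad (Suc d) (tile j) p"
    "\<not> (quad (d + 2) (tile j) p \<and> quad (d + 3) (tile i) p)"
    using contact_quad assms(1-5) by blast
  obtain k where k: "k \<in> I" "quad (d + 2) (tile k) p" using p by (auto intro: quad_exists[of p "d + 2"])
  obtain l where l: "l \<in> I" "quad (d + 3) (tile l) p" using p by (auto intro: quad_exists[of p "d + 3"])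
  \<comment> \<open>A tile in two opposite quadrants would cover the other tile's quadrant as
    well.\<close>
  have "k \<noteq> i" using k d i j \<open>i \<noteq> j\<close> quad_opposite quad_eq by blast
  have "l \<noteq> j" using l d i j \<open>i \<noteq> j\<close> quad_opposite[of "Suc d" "tile j" p] quad_eq
    by (metis add_Suc_shift numeral_2_eq_2 numeral_3_eq_3)
  have uniq: "quad d (tile n) p \<longleftrightarrow> n = i" "quad (Suc d) (tile n) p \<longleftrightarrow> n = j" 
      "quad (d + 2) (tile n) p \<longleftrightarrow> n = k" "quad (d + 3) (tile n) p \<longleftrightarrow> n = l" if "n \<in> I" for n
    using that i j k l d quad_eq by blast+
  have shift: "Suc d + 2 = d + 3" "Suc (Suc d) = d + 2" "Suc d + 3 = d + 4"
    "d + 2 + 2 = d + 4" "d + 2 + 3 = d + 5" "d + 3 + 2 = d + 5" "Suc (d + 2) = d + 3" by auto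
  have jk: "touch (tile j) (tile k) \<and> left_end (tile j) (tile k) = p" if "j \<noteq> k"
    using quad_contact[of j k "Suc d" p, unfolded shift quad_add_4] that uniq i j k \<open>i \<noteq> j\<close> by blast
  have kl: "touch (tile k) (tile l) \<and> left_end (tile k) (tile l) = p" if "k \<noteq> l" "l \<noteq> i \<or> k \<noteq> j"
    using quad_contact[of k l "d + 2" p, unfolded shift quad_add_4] that uniq i j k l by blast
  have li: "touch (tile l) (tile i) \<and> left_end (tile l) (tile i) = p" if "l \<noteq> i"
    using quad_contact[of l i "d + 3" p, unfolded shift quad_add_4] that uniq i j l \<open>i \<noteq> j\<close> by blast
  \<comment> \<open>Otherwise four distinct tiles would share \<open>p\<close>.\<close>
  have "k = j \<or> l = i \<or> k = l"
    using not_four_tiles[of i j k l p] i j k l d \<open>i \<noteq> j\<close> \<open>k \<noteq> i\<close> \<open>l \<noteq> j\<close> quad_mem by (metis empty_subsetI insert_subset)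
  \<comment> \<open>Both equations together would make \<open>p\<close> an inner point of the
    contact of \<open>i\<close> and \<open>j\<close>.\<close>
  moreover have "k \<noteq> j \<or> l \<noteq> i" using uniq d(3) i j by blast
  ultimately show thesis
    using that[of k] that[of l] jk kl li k(1) l(1) \<open>k \<noteq> i\<close> \<open>l \<noteq> j\<close> by metis
qed

lemma touch_meet:
  assumes "i \<in> I" "j \<in> I" "i \<noteq> j" "touch (tile i) (tile j)"
  shows "xl (tile i) \<le> xr (tile j)" "xl (tile j) \<le> xr (tile i)" "yb (tile i) \<le> yt (tile j)" "yb (tile j) \<le> yt (tile i)"
  using assms(4) unfolding touch_def mem_region subset_iff Int_iff
  by (metis ends_in_segment(1) order_trans)+

text \<open>Each tile at \<open>p\<close> needs a quadrant of its own, but at a point of a bounding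
  line only two quadrants lie in the strip.\<close>

lemma three_tiles_inside:
  assumes I: "i \<in> I" "j \<in> I" "m \<in> I" and neq: "i \<noteq> j" "j \<noteq> m" "m \<noteq> i"
    and p: "p \<in> region (tile i)" "p \<in> region (tile j)" "p \<in> region (tile m)"
  shows "B < snd p" "snd p < D"
proof -
  obtain a b c where q: "quad a (tile i) p" "quad b (tile j) p" "quad c (tile m) p"
    using ex_quad p I proper by metis
  have neq': "a mod 4 \<noteq> b mod 4" "b mod 4 \<noteq> c mod 4" "c mod 4 \<noteq> a mod 4"
    using q quad_eq neq I by (metis quad_cong)+
  have four: "d mod 4 \<in> {0, 1} \<or> d mod 4 \<in> {2, 3}" for d :: nat by (rule mod_4_cases[of d]) auto
  have *: "d mod 4 \<in> {0, 1} \<Longrightarrow> snd p < D" "d mod 4 \<in> {2, 3} \<Longrightarrow> B < snd p" if "n \<in> I" "quad d (tile n) p" for n d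
    using that tile_bounds[OF that(1)] by (auto simp: quad_def)
  show "snd p < D"
  proof (rule ccontr)
    assume "\<not> snd p < D"
    then have "a mod 4 \<in> {2, 3}" "b mod 4 \<in> {2, 3}" "c mod 4 \<in> {2, 3}" using * I q four by blast+
    then show False using neq' by auto
  qed
  show "B < snd p"
  proof (rule ccontr)
    assume "\<not> B < snd p"
    then have "a mod 4 \<in> {0, 1}" "b mod 4 \<in> {0, 1}" "c mod 4 \<in> {0, 1}" using * I q four by blast+
    then show False using neq' by auto
  qed
qed

text \<open>The two alternatives are the counterclockwise orders \<open>i\<close>, \<open>j\<close>,
  \<open>m\<close> and \<open>i\<close>, \<open>m\<close>, \<open>j\<close> around the common
  point.\<close>

lemma three_touching_tiles:
  assumes I: "i \<in> I" "j \<in> I" "m \<in> I" and neq: "i \<noteq> j" "j \<noteq> m" "m \<noteq> i"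
    and touch: "touch (tile i) (tile j)" "touch (tile j) (tile m)" "touch (tile m) (tile i)"
  obtains p where "B < snd p" "snd p < D"
    "left_end (tile i) (tile j) = p \<and> left_end (tile j) (tile m) = p \<and> left_end (tile m) (tile i) = p \<or>
     left_end (tile j) (tile i) = p \<and> left_end (tile i) (tile m) = p \<and> left_end (tile m) (tile j) = p"
proof -
  \<comment> \<open>The lower left corner of the triple intersection. Pairwise touching gives all
    the inequalities needed, coordinate by coordinate.\<close>
  define p where "p = (max (xl (tile i)) (max (xl (tile j)) (xl (tile m))), max (yb (tile i)) (max (yb (tile j)) (yb (tile m))))"
  have p: "p \<in> region (tile i)" "p \<in> region (tile j)" "p \<in> region (tile m)"
    using touch_meet[OF I(1,2) neq(1) touch(1)] touch_meet[OF I(2,3) neq(2) touch(2)] touch_meet[OF I(3,1) neq(3) touch(3)]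
      tile_bounds[OF I(1)] tile_bounds[OF I(2)] tile_bounds[OF I(3)]
    by (auto simp: p_def mem_region)
  note inside = three_tiles_inside[OF I neq p]
  have only: "n \<in> {i, j, m}" if "n \<in> I" "p \<in> region (tile n)" for n
    using not_four_tiles[of i j m n p] that I neq p by auto
  \<comment> \<open>The last quadrant of \<open>i\<close> counterclockwise. Tile \<open>i\<close>
    cannot cover two opposite quadrants, because \<open>j\<close> needs one too.\<close>
  obtain e where e: "quad e (tile i) p" "\<not> quad (Suc e) (tile i) p"
  proof -
    obtain d where d: "quad d (tile i) p" using ex_quad I p proper by blast
    obtain d' where d': "quad d' (tile j) p" using ex_quad I p proper by blast
    have "\<not> quad (d + 2) (tile i) p"
      using quad_opposite[OF d] d' quad_eq[of i j d' p] I neq by blast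
    then show thesis using that[of d] that[of "Suc d"] d by auto
  qed
  obtain n where n: "n \<in> I" "quad (Suc e) (tile n) p"
    using inside by (auto intro: quad_exists[of p "Suc e"])
  then have "n = j \<or> n = m" using only[of n] e(2) quad_mem by blast
  then obtain n' where n': "n' \<in> I" "n' \<noteq> i" "n' \<noteq> n" "p \<in> region (tile n')" "n = j \<and> n' = m \<or> n = m \<and> n' = j" "n \<noteq> i"
    using I neq p by blast
  obtain f where f: "quad f (tile n') p" using ex_quad n' proper by blast
  \<comment> \<open>Otherwise \<open>i\<close> and \<open>n\<close> would fill all four quadrants
    and leave none for \<open>n'\<close>.\<close>
  have "\<not> (quad (e + 2) (tile n) p \<and> quad (e + 3) (tile i) p)"
  proof
    assume *: "quad (e + 2) (tile n) p \<and> quad (e + 3) (tile i) p"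
    have "f mod 4 \<noteq> g mod 4" if "quad g (tile n) p \<or> quad g (tile i) p" for g
      using that quad_eq[OF n'(1) n(1)] quad_eq[OF n'(1) I(1)] f n'(2,3) by (metis quad_cong)
    then have "f mod 4 \<noteq> e mod 4" "f mod 4 \<noteq> Suc e mod 4" "f mod 4 \<noteq> (e + 2) mod 4" "f mod 4 \<noteq> (e + 3) mod 4"
      using * n(2) e(1) by blast+
    then show False using mod_4_complete by blast
  qed
  then have in_contact: "touch (tile i) (tile n)" "left_end (tile i) (tile n) = p"
    using quad_contact[of i n e p] I n e(1) n' by auto
  obtain m' where m': "m' \<in> I" "m' \<noteq> i" "m' \<noteq> n"
    "touch (tile n) (tile m')" "left_end (tile n) (tile m') = p"
    "touch (tile m') (tile i)" "left_end (tile m') (tile i) = p"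
    using third_tile[OF I(1) n(1) _ in_contact inside] n' by metis
  then have "p \<in> region (tile m')"
    using contact_quad[of m' i p] I(1) quad_mem by metis
  then have "m' = n'" using only m' n' by blast
  then show thesis using that[OF inside] n'(5) m' in_contact by blast
qed

section \<open>Neighbours on the four sides of a tile\<close>

text \<open>Chosen at the upper right corner, so that the right neighbour of a tile at the top of
  the strip also reaches the top. \<open>left_neighbour\<close> uses the lower left corner for the
  bottom in the same way.\<close>

lemma right_neighbour:
  assumes "i \<in> I"
  obtains j where "j \<in> I" "beside (tile i) (tile j)" "yt (tile i) \<le> yt (tile j)"
proof -
  note i = tile_bounds[OF assms]
  obtain j where j: "j \<in> I" "quad 3 (tile j) (xr (tile i), yt (tile i))"
    using i by (auto intro: quad_exists[of "(xr (tile i), yt (tile i))" 3])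
  with i have "i \<noteq> j" by (auto simp: quad_def)
  with j assms have "separated (tile i) (tile j)" by (simp add: separated_tiles)
  with i j that show thesis by (auto simp: quad_def separated_def beside_def)
qed

lemma left_neighbour:
  assumes "i \<in> I"
  obtains j where "j \<in> I" "beside (tile j) (tile i)" "yb (tile j) \<le> yb (tile i)"
proof -
  note i = tile_bounds[OF assms]
  obtain j where j: "j \<in> I" "quad 1 (tile j) (xl (tile i), yb (tile i))"
    using i by (auto intro: quad_exists[of "(xl (tile i), yb (tile i))" 1])
  with i have "i \<noteq> j" by (auto simp: quad_def)
  with j assms have "separated (tile i) (tile j)" by (simp add: separated_tiles)
  with i j that show thesis by (auto simp: quad_def separated_def beside_def)
qed

lemma upper_neighbour:
  assumes "i \<in> I" "yt (tile i) < D"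
  obtains j where "j \<in> I" "stacked (tile i) (tile j)"
proof -
  note i = tile_bounds[OF assms(1)]
  obtain j where j: "j \<in> I" "quad 0 (tile j) (xl (tile i), yt (tile i))"
    using i assms by (auto intro: quad_exists[of "(xl (tile i), yt (tile i))" 0])
  with i have "i \<noteq> j" by (auto simp: quad_def)
  with j assms have "separated (tile i) (tile j)" by (simp add: separated_tiles)
  with i j that show thesis by (auto simp: quad_def separated_def stacked_def)
qed

lemma lower_neighbour:
  assumes "i \<in> I" "B < yb (tile i)"
  obtains j where "j \<in> I" "stacked (tile j) (tile i)"
proof -
  note i = tile_bounds[OF assms(1)]
  obtain j where j: "j \<in> I" "quad 3 (tile j) (xl (tile i), yb (tile i))"
    using i assms by (auto intro: quad_exists[of "(xl (tile i), yb (tile i))" 3])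
  with i have "i \<noteq> j" by (auto simp: quad_def)
  with j assms have "separated (tile i) (tile j)" by (simp add: separated_tiles)
  with i j that show thesis by (auto simp: quad_def separated_def stacked_def)
qed

end

section \<open>Faces of the dual graph\<close>

lemma translate_simps [simp]:
  "xl (translate w r) = xl r + fst w" "xr (translate w r) = xr r + fst w"
  "yb (translate w r) = yb r + snd w" "yt (translate w r) = yt r + snd w"
  by (simp_all add: translate_def)

lemma translate_translate: "translate w (translate w' r) = translate (w + w') r"
  by (simp add: translate_def add_ac)

lemma translate_0: "translate 0 r = r"
  by (simp add: translate_def)

lemma proper_translate: "proper_rect (translate w r) \<longleftrightarrow> proper_rect r"
  by (simp add: proper_rect_def)

lemma touch_translate: "touch (translate w r) (translate w s) \<longleftrightarrow> touch r s"
proof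
  have *: "touch (translate w r) (translate w s)" if rs: "touch r s" for w r s
  proof -
    obtain p q where "p \<noteq> q" "closed_segment p q \<subseteq> region r \<inter> region s"
      using rs unfolding touch_def by blast
    moreover have "w + x \<in> region (translate w r)" if "x \<in> region r" for x r
      using that by (simp add: mem_region)
    ultimately have "w + p \<noteq> w + q" and "(+) w ` closed_segment p q \<subseteq> region (translate w r) \<inter> region (translate w s)"
      by (simp, blast)
    moreover have "closed_segment (w + p) (w + q) = (+) w ` closed_segment p q"
      using closed_segment_translation by blast
    ultimately have "w + p \<noteq> w + q" "closed_segment (w + p) (w + q) \<subseteq> region (translate w r) \<inter> region (translate w s)"
      by simp_all
    then show ?thesis unfolding touch_def by blast
  qed
  show "touch r s \<Longrightarrow> touch (translate w r) (translate w s)" by (rule *)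
  show "touch r s" if "touch (translate w r) (translate w s)"
    using *[OF that, of "- w"] by (simp add: translate_translate translate_0)
qed

lemma left_end_translate: "left_end (translate w r) (translate w s) = left_end r s + w"
  unfolding left_end_def translate_simps add_right_cancel max_add_distrib_left[symmetric] min_add_distrib_left[symmetric]
  by (cases w) (simp only: add_Pair fst_conv snd_conv split: if_split, blast)

lemma cw_pos_translate: "cw_pos (translate w r) (p + w) = cw_pos r p"
proof -
  have w: "width (translate w r) = width r" "height (translate w r) = height r"
    by (simp_all add: width_def height_def)
  show ?thesis unfolding cw_pos_def w translate_simps by simp
qed

lemma cw_dist_translate: "cw_dist (translate w r) (p + w) (q + w) = cw_dist r p q"
  by (simp add: cw_dist_def cw_pos_translate) (simp add: width_def height_def)

lemma beside_translate: "beside (translate w r) (translate w s) \<longleftrightarrow> beside r s"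
  by (simp add: beside_def)

section \<open>The periodic tiling of a dual and its arcs\<close>

definition tile_of :: "real \<Rightarrow> ('v \<Rightarrow> rect) \<Rightarrow> 'v \<times> int \<Rightarrow> rect" where
  "tile_of T R i = translate (of_int (snd i) * T, 0) (R (fst i))"

lemma tile_of_0 [simp]: "tile_of T R (v, 0) = R v"
  by (simp add: tile_of_def translate_def prod_eq_iff)

lemma tile_of_simps [simp]:
  "xl (tile_of T R i) = xl (R (fst i)) + of_int (snd i) * T"
  "xr (tile_of T R i) = xr (R (fst i)) + of_int (snd i) * T"
  "yb (tile_of T R i) = yb (R (fst i))" "yt (tile_of T R i) = yt (R (fst i))"
  by (simp_all add: tile_of_def)

lemma translate_tile_of:
  "translate (of_int k * T, 0) (tile_of T R (v, l)) = tile_of T R (v, k + l)"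
  by (simp add: tile_of_def translate_translate distrib_right)

text \<open>A rectangular dual whose period is the horizontal vector \<open>(T, 0)\<close>, with the
  frontier condition turned into a condition on the second coordinate.\<close>

locale horizontal_dual = cylindrical_graph G arev rot outer +
  strip_tiling "verts G \<times> (UNIV :: int set)" "tile_of T R" B D
  for G :: "('v, 'a) pre_digraph" and arev rot outer
    and T :: real and R :: "'v \<Rightarrow> rect" and B D :: real +
  fixes lift :: "'a \<Rightarrow> int"
  assumes T_pos: "0 < T"
    and contacts: "bij_betw (\<lambda>a. (tail G a, head G a, lift a)) (arcs G)
      {(u, v, k). u \<in> verts G \<and> v \<in> verts G \<and> (u, 0) \<noteq> (v, k) \<and> touch (R u) (tile_of T R (v, k))}"
    and lift_arev: "a \<in> arcs G \<Longrightarrow> lift (arev a) = - lift a"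
    and rot_next: "a \<in> arcs G \<Longrightarrow> b \<in> out_arcs G (tail G a) \<Longrightarrow>
      cw_dist (R (tail G a)) (left_end (R (tail G a)) (tile_of T R (head G a, lift a)))
        (left_end (R (tail G (rot a))) (tile_of T R (head G (rot a), lift (rot a))))
      \<le> cw_dist (R (tail G a)) (left_end (R (tail G a)) (tile_of T R (head G a, lift a)))
        (left_end (R (tail G b)) (tile_of T R (head G b, lift b)))"
    and outer_iff: "a \<in> arcs G \<Longrightarrow> left_face a \<in> outer \<longleftrightarrow>
      snd (left_end (R (tail G a)) (tile_of T R (head G a, lift a))) \<in> {B, D}"
begin

abbreviation tile :: "'v \<times> int \<Rightarrow> rect" where "tile \<equiv> tile_of T R"
abbreviation tiles :: "('v \<times> int) set" where "tiles \<equiv> verts G \<times> UNIV"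

text \<open>
  The arc \<open>a\<close> crosses the contact of tile \<open>i\<close> with tile \<open>j\<close>. Translates of this contact are crossed by
  the same arc.
\<close>

definition draws :: "'a \<Rightarrow> 'v \<times> int \<Rightarrow> 'v \<times> int \<Rightarrow> bool" where
  "draws a i j \<longleftrightarrow> a \<in> arcs G \<and> tail G a = fst i \<and> head G a = fst j \<and> lift a = snd j - snd i"

lemma draws_self: "a \<in> arcs G \<Longrightarrow> draws a (tail G a, k) (head G a, lift a + k)"
  by (simp add: draws_def)

lemma draws_unique:
  assumes "draws a i j" "draws b i j"
  shows "a = b"
  using assms bij_betw_imp_inj_on[OF contacts] unfolding draws_def inj_on_def by auto

lemma draws_arev: "draws a i j \<Longrightarrow> draws (arev a) j i"
  by (simp add: draws_def lift_arev)

lemma tile_translate: "tile i = translate (of_int k * T, 0) (tile (fst i, snd i - k))"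
  by (simp add: translate_tile_of)

lemma touch_tiles_iff: "touch (tile i) (tile j) \<longleftrightarrow> touch (R (fst i)) (tile (fst j, snd j - snd i))"
  using tile_translate[of i "snd i"] tile_translate[of j "snd i"] touch_translate by simp

lemma ex_draws_iff:
  assumes "i \<in> tiles" "j \<in> tiles"
  shows "(\<exists>a. draws a i j) \<longleftrightarrow> i \<noteq> j \<and> touch (tile i) (tile j)"
proof -
  have "(\<exists>a. draws a i j) \<longleftrightarrow> (fst i, fst j, snd j - snd i) \<in> (\<lambda>a. (tail G a, head G a, lift a)) ` arcs G"
    unfolding draws_def image_iff by (simp add: eq_commute) metis
  also have "\<dots> \<longleftrightarrow> i \<noteq> j \<and> touch (tile i) (tile j)"
    using assms unfolding bij_betw_imp_surj_on[OF contacts] touch_tiles_iff[of i j] by (auto simp: prod_eq_iff)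
  finally show ?thesis .
qed

lemma drawsD:
  assumes "draws a i j"
  shows "i \<in> tiles" "j \<in> tiles" "i \<noteq> j" "touch (tile i) (tile j)" "a \<in> arcs G"
    "proper_rect (tile i)" "proper_rect (tile j)" "separated (tile i) (tile j)"
proof -
  show a: "a \<in> arcs G" using assms by (simp add: draws_def)
  then show i: "i \<in> tiles" and j: "j \<in> tiles"
    using assms by (auto simp: draws_def mem_Times_iff dest: wellformed)
  show "i \<noteq> j" "touch (tile i) (tile j)" using ex_draws_iff i j assms by blast+
  then show "proper_rect (tile i)" "proper_rect (tile j)" "separated (tile i) (tile j)"
    using i j proper separated_tiles by blast+
qed

lemma left_end_draws:
  assumes "draws a i j"
  shows "left_end (tile i) (tile j) =
    left_end (R (tail G a)) (tile (head G a, lift a)) + (of_int (snd i) * T, 0)"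
proof -
  let ?w = "(of_int (snd i) * T, 0)"
  have "tile i = translate ?w (R (tail G a))" "tile j = translate ?w (tile (head G a, lift a))"
    using assms tile_translate[of i "snd i"] tile_translate[of j "snd i"] by (simp_all only: draws_def diff_self tile_of_0)
  then show ?thesis by (simp only: left_end_translate)
qed

lemma rot_out_arcs: "a \<in> arcs G \<Longrightarrow> rot a \<in> out_arcs G (tail G a)"
proof -
  assume "a \<in> arcs G"
  then have "a \<in> out_arcs G (tail G a)" "tail G a \<in> verts G" by auto
  then have "cyclic_on rot (out_arcs G (tail G a))" by (intro rot_cyclic) auto
  then show ?thesis using \<open>a \<in> out_arcs G (tail G a)\<close> by (rule cyclic_on_inI)
qed

section \<open>Rotation and inner faces\<close>

text \<open>Both \<open>b\<close> and \<open>rot a\<close> minimise the clockwise distance from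
  \<open>a\<close>, and the minimiser is unique because distinct contacts start at distinct
  points.\<close>

lemma rot_eq:
  assumes a: "draws a j i" and b: "draws b j m"
    and min: "\<And>n. n \<in> tiles \<Longrightarrow> n \<noteq> j \<Longrightarrow> touch (tile j) (tile n) \<Longrightarrow>
      cw_dist (tile j) (left_end (tile j) (tile i)) (left_end (tile j) (tile m))
      \<le> cw_dist (tile j) (left_end (tile j) (tile i)) (left_end (tile j) (tile n))"
  shows "rot a = b"
proof -
  have arcs: "a \<in> arcs G" "b \<in> out_arcs G (tail G a)" "tail G a = fst j" "rot a \<in> out_arcs G (tail G a)"
    using a b rot_out_arcs by (auto simp: draws_def)
  define n where "n = (head G (rot a), lift (rot a) + snd j)"
  have n: "draws (rot a) j n" using arcs by (auto simp: draws_def n_def)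
  have tile_j: "tile j = translate (of_int (snd j) * T, 0) (R (fst j))"
    using tile_translate[of j "snd j"] by simp
  have "cw_dist (tile j) (left_end (tile j) (tile i)) (left_end (tile j) (tile n))
    \<le> cw_dist (tile j) (left_end (tile j) (tile i)) (left_end (tile j) (tile m))"
    unfolding left_end_draws[OF a] left_end_draws[OF b] left_end_draws[OF n]
    using rot_next[OF arcs(1,2)] unfolding tile_j cw_dist_translate arcs(3) .
  with min[of n] drawsD[OF n]
  have "cw_dist (tile j) (left_end (tile j) (tile i)) (left_end (tile j) (tile n))
    = cw_dist (tile j) (left_end (tile j) (tile i)) (left_end (tile j) (tile m))"
    by force
  then have "\<not> separated (tile n) (tile m)"
    using cw_pos_inj cw_dist_inj drawsD[OF n] drawsD[OF b] by metis
  then have "n = m" using separated_tiles drawsD[OF n] drawsD[OF b] by blast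
  then show ?thesis using draws_unique n b by blast
qed

text \<open>Around \<open>j\<close>, the contact with \<open>i\<close> ends clockwise at
  \<open>left_end (tile i) (tile j)\<close>. The contact with \<open>m\<close> starts right there,
  so nothing comes between.\<close>

lemma face_succ_eq:
  assumes "draws a i j" "draws b j m" "left_end (tile i) (tile j) = left_end (tile j) (tile m)"
  shows "face_succ a = b"
proof -
  have "rot (arev a) = b"
  proof (rule rot_eq[OF draws_arev[OF assms(1)] assms(2)])
    fix n assume n: "n \<in> tiles" "n \<noteq> j" "touch (tile j) (tile n)"
    note ij = drawsD[OF draws_arev[OF assms(1)]]
    have "tile i = tile n \<or> separated (tile i) (tile n)"
      using separated_tiles[OF ij(2) n(1)] by blast
    moreover have "proper_rect (tile n)" "separated (tile j) (tile n)"
      using separated_tiles[OF ij(1) n(1)] proper[OF n(1)] n(2) by blast+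
    ultimately show "cw_dist (tile j) (left_end (tile j) (tile i)) (left_end (tile j) (tile m))
        \<le> cw_dist (tile j) (left_end (tile j) (tile i)) (left_end (tile j) (tile n))"
      unfolding assms(3)[symmetric]
      using ij(4,6,7,8) n(3) by (intro cw_dist_contact_end)
  qed
  then show ?thesis by (simp add: face_succ_def)
qed

lemma inner_left_face:
  assumes "draws a i j" "draws b j m" "draws c m i" and "left_end (tile i) (tile j) = p"
    "left_end (tile j) (tile m) = p" "left_end (tile m) (tile i) = p"
  shows "left_face a = {a, b, c}" "face_succ a = b" "face_succ b = c" "face_succ c = a"
proof -
  show *: "face_succ a = b" "face_succ b = c" "face_succ c = a"
    using assms face_succ_eq by auto
  have "x \<in> {a, b, c}" if "x \<in> orbit face_succ a" for x
    using that by induction (auto simp: *)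
  moreover have "b \<in> orbit face_succ a" "c \<in> orbit face_succ a" "a \<in> orbit face_succ a"
    using orbit.base[of face_succ a] orbit.step[of _ face_succ a] * by metis+
  ultimately show "left_face a = {a, b, c}" unfolding left_face_def by blast
qed

lemma left_end_inside:
  assumes "draws a i j" "left_face a \<notin> outer"
  shows "B < snd (left_end (tile i) (tile j))" "snd (left_end (tile i) (tile j)) < D"
proof -
  let ?p = "left_end (tile i) (tile j)"
  have "?p \<in> region (tile i)"
    using contact_quad drawsD[OF assms(1)] quad_mem by metis
  then have "B \<le> snd ?p" "snd ?p \<le> D"
    using tile_bounds drawsD(1)[OF assms(1)] by (force simp: mem_region)+
  moreover have "snd ?p \<noteq> B" "snd ?p \<noteq> D"
    using assms outer_iff[of a] drawsD(5)[OF assms(1)] left_end_draws[OF assms(1)] by auto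
  ultimately show "B < snd ?p" "snd ?p < D" by simp_all
qed

text \<open>The third tile at the left end of the contact supplies the other two arcs of the
  face.\<close>

lemma ex_inner_left_face:
  assumes "a \<in> arcs G" "left_face a \<notin> outer"
  obtains i j m b c where "draws a i j" "draws b j m" "draws c m i" "m \<noteq> i"
    "left_face a = {a, b, c}" "face_succ a = b" "face_succ b = c" "face_succ c = a"
proof -
  define i j where "i = (tail G a, 0 :: int)" and "j = (head G a, lift a)"
  have a: "draws a i j" using draws_self[OF assms(1), of 0] by (simp add: i_def j_def)
  note ij = drawsD[OF a]
  obtain m where m: "m \<in> tiles" "m \<noteq> i" "m \<noteq> j"
    "touch (tile j) (tile m)" "left_end (tile j) (tile m) = left_end (tile i) (tile j)"
    "touch (tile m) (tile i)" "left_end (tile m) (tile i) = left_end (tile i) (tile j)"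
    using third_tile[OF ij(1-4) refl left_end_inside[OF a assms(2)]] by metis
  then obtain b c where bc: "draws b j m" "draws c m i"
    using ex_draws_iff ij by metis
  show thesis
    using that[OF a bc m(2)] inner_left_face[OF a bc refl m(5,7)] by blast
qed

section \<open>Loops and triangles\<close>

text \<open>Translates of one rectangle have the same vertical extent, so they touch side by side
  and their offset equals the width.\<close>

lemma lift_between_translates:
  assumes "draws a i j" "fst i = fst j"
  shows "\<bar>of_int (lift a)\<bar> * T = xr (R (fst i)) - xl (R (fst i))"
proof (rule touch_cases[OF drawsD(6,7,8,4)[OF assms(1)]])
  note i = tile_bounds[OF drawsD(1)[OF assms(1)]]
  have sgn: "0 < of_int (lift a) * T \<Longrightarrow> 0 < lift a" "of_int (lift a) * T < 0 \<Longrightarrow> lift a < 0"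
    using T_pos by (simp_all add: zero_less_mult_iff mult_less_0_iff)
  have "of_int (snd j) * T - of_int (snd i) * T = of_int (lift a) * T"
    using assms by (simp only: draws_def of_int_diff left_diff_distrib)
  moreover assume "beside (tile i) (tile j)"
  ultimately show ?thesis using i assms(2) sgn by (simp add: beside_def)
next
  note i = tile_bounds[OF drawsD(1)[OF assms(1)]]
  have sgn: "0 < of_int (lift a) * T \<Longrightarrow> 0 < lift a" "of_int (lift a) * T < 0 \<Longrightarrow> lift a < 0"
    using T_pos by (simp_all add: zero_less_mult_iff mult_less_0_iff)
  have "of_int (snd j) * T - of_int (snd i) * T = of_int (lift a) * T"
    using assms by (simp only: draws_def of_int_diff left_diff_distrib)
  moreover assume "beside (tile j) (tile i)"
  ultimately show ?thesis using i assms(2) sgn by (simp add: beside_def)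
qed (use assms(2) tile_bounds[OF drawsD(1)[OF assms(1)]] in \<open>simp_all add: stacked_def\<close>)

text \<open>All three lifts would have the same nonzero absolute value, and three such numbers do
  not sum to zero.\<close>

lemma not_three_translates:
  assumes "draws a i j" "draws b j m" "draws c m i"
  shows "\<not> (fst i = fst j \<and> fst j = fst m)"
proof
  assume "fst i = fst j \<and> fst j = fst m"
  then have "\<bar>of_int (lift a)\<bar> * T = \<bar>of_int (lift b)\<bar> * T" "\<bar>of_int (lift b)\<bar> * T = \<bar>of_int (lift c)\<bar> * T"
    using lift_between_translates assms by metis+
  then have "\<bar>lift a\<bar> = \<bar>lift b\<bar>" "\<bar>lift b\<bar> = \<bar>lift c\<bar>"
    using T_pos by (auto simp: of_int_abs[symmetric] simp del: of_int_abs)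
  moreover have "lift a + lift b + lift c = 0" using assms by (simp add: draws_def)
  moreover have "lift a \<noteq> 0"
    using drawsD(3)[OF assms(1)] assms(1) \<open>fst i = _ \<and> _\<close> by (auto simp: draws_def prod_eq_iff)
  ultimately show False by linarith
qed

text \<open>Equal arcs would identify the vertices of all three tiles, and reverse arcs would force
  \<open>m = i\<close>.\<close>

lemma draws_edges_disjoint:
  assumes "draws a i j" "draws b j m" "m \<noteq> i" "\<not> (fst i = fst j \<and> fst j = fst m)"
  shows "{a, arev a} \<inter> {b, arev b} = {}"
proof -
  have "a \<noteq> b" using assms(1,2,4) unfolding draws_def by metis
  moreover have "a \<noteq> arev b"
  proof
    assume "a = arev b"
    then have "draws a m j" using draws_arev[OF assms(2)] by simp
    then have "fst i = fst m" "snd j - snd i = snd j - snd m"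
      using assms(1) unfolding draws_def by metis+
    then have "i = m" by (simp add: prod_eq_iff)
    then show False using assms(3) by simp
  qed
  moreover have "arev a \<noteq> arev b" using \<open>a \<noteq> b\<close> arev_arev by metis
  moreover have "arev a \<noteq> b" using \<open>a \<noteq> arev b\<close> arev_arev by metis
  ultimately show ?thesis by simp
qed

lemma triangle_draws:
  assumes "draws a i j" "draws b j m" "draws c m i" "m \<noteq> i"
  shows "triangle a b c"
proof -
  have "{a, arev a} \<inter> {b, arev b} = {}" "{b, arev b} \<inter> {c, arev c} = {}" "{c, arev c} \<inter> {a, arev a} = {}"
    using draws_edges_disjoint[OF assms(1,2)] draws_edges_disjoint[OF assms(2,3)] draws_edges_disjoint[OF assms(3,1)]
      not_three_translates[OF assms(1-3)] drawsD(3) assms by metis+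
  then show ?thesis
    using assms not_three_translates[OF assms(1-3)] unfolding triangle_def draws_def by auto
qed

lemma inner_faceD:
  assumes "f \<in> inner_faces"
  shows "\<exists>a. triangle a (face_succ a) (face_succ (face_succ a)) \<and> f = {a, face_succ a, face_succ (face_succ a)}"
proof -
  obtain a where "a \<in> arcs G" "f = left_face a" "left_face a \<notin> outer"
    using assms by (auto simp: inner_faces_def faces_def)
  then show ?thesis using triangle_draws by (metis ex_inner_left_face)
qed

section \<open>Lifts as a homotopy invariant\<close>

lemma sum_lift_null_piece:
  assumes "null_piece p"
  shows "sum_list (map lift p) = 0"
proof -
  obtain a where a: "a \<in> arcs G" and
    p: "p = [a, arev a] \<or> left_face a \<in> inner_faces \<and> p = map (\<lambda>i. (face_succ ^^ i) a) [0..<card (left_face a)]"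
    using assms unfolding null_piece_def by blast
  from p show ?thesis
  proof
    assume "p = [a, arev a]"
    then show ?thesis using lift_arev[OF a] by simp
  next
    assume inner: "left_face a \<in> inner_faces \<and> p = map (\<lambda>i. (face_succ ^^ i) a) [0..<card (left_face a)]"
    then have "left_face a \<notin> outer" by (simp add: inner_faces_def)
    then obtain i j m b c where abc: "draws a i j" "draws b j m" "draws c m i" "m \<noteq> i"
      "left_face a = {a, b, c}" "face_succ a = b" "face_succ b = c"
      using ex_inner_left_face[OF a] by metis
    \<comment> \<open>The arcs of a \<open>triangle\<close> are distinct, so the boundary walk is
      \<open>[a, b, c]\<close> and its lifts telescope around the three tiles.\<close>
    then have "card (left_face a) = 3"
      using triangle_draws[OF abc(1-4)] by (auto simp: triangle_def card_insert_if)
    then have "p = [a, b, c]" using inner abc(6,7) by (simp add: upt_rec)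
    then show ?thesis using abc(1-3) by (simp add: draws_def)
  qed
qed

text \<open>The sum counts the periods by which the walk moves when lifted to the plane, that is,
  its winding number; inserting a null piece preserves it.\<close>

lemma contractible_sum_lift:
  assumes "contractible p"
  shows "sum_list (map lift p) = 0"
proof -
  have step: "sum_list (map lift q) = sum_list (map lift r)" if "homotopy_step q r" for q r
    using that sum_lift_null_piece unfolding homotopy_step_def by fastforce
  have "sum_list (map lift p) = sum_list (map lift q)" if "equivclp homotopy_step p q" for q
    using that by (induction rule: equivclp_induct) (auto dest: step)
  from this[of "[]"] assms show ?thesis by (simp add: contractible_def)
qed

text \<open>With lift 0 the arc would cross a contact of a tile with itself.\<close>

lemma loop_lift_nonzero: "a \<in> arcs G \<Longrightarrow> tail G a = head G a \<Longrightarrow> lift a \<noteq> 0"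
  using drawsD(3)[OF draws_self[of a 0]] by auto

lemma parallel_lift_neq:
  assumes "parallel a b"
  shows "lift a \<noteq> lift b"
proof
  assume "lift a = lift b"
  then have "draws a (tail G a, 0) (head G a, lift a)" "draws b (tail G a, 0) (head G a, lift a)"
    using assms by (auto simp: parallel_def draws_def)
  then show False using draws_unique assms unfolding parallel_def by metis
qed

text \<open>The walk closes up in the plane, so its tiles touch pairwise and meet in a point. Their
  cyclic order around it decides which orientation bounds the face.\<close>

lemma triangle_face:
  assumes "triangle a b c" "lift a + lift b + lift c = 0"
  shows "{a, b, c} \<in> faces \<or> {arev a, arev b, arev c} \<in> faces"
proof -
  define i j m where "i = (tail G a, 0 :: int)" and "j = (head G a, lift a)" and "m = (head G b, lift a + lift b)"
  have abc: "draws a i j" "draws b j m" "draws c m i"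
    using assms by (auto simp: draws_def triangle_def i_def j_def m_def)
  note ij = drawsD[OF abc(1)] and jm = drawsD[OF abc(2)] and mi = drawsD[OF abc(3)]
  from three_touching_tiles[OF ij(1,2) mi(1) ij(3) jm(3) mi(3) ij(4) jm(4) mi(4)]
  obtain p where "left_end (tile i) (tile j) = p \<and> left_end (tile j) (tile m) = p \<and> left_end (tile m) (tile i) = p \<or>
     left_end (tile j) (tile i) = p \<and> left_end (tile i) (tile m) = p \<and> left_end (tile m) (tile j) = p"
    by metis
  then show ?thesis
  proof
    assume "left_end (tile i) (tile j) = p \<and> left_end (tile j) (tile m) = p \<and> left_end (tile m) (tile i) = p"
    then have "left_face a = {a, b, c}" using inner_left_face(1)[OF abc] by simp
    then show ?thesis using ij(5) unfolding faces_def by blast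
  next
    assume "left_end (tile j) (tile i) = p \<and> left_end (tile i) (tile m) = p \<and> left_end (tile m) (tile j) = p"
    then have "left_face (arev a) = {arev a, arev c, arev b}"
      using inner_left_face(1)[OF abc(1,3,2)[THEN draws_arev]] by simp
    moreover have "arev a \<in> arcs G" using ij(5) by simp
    ultimately show ?thesis unfolding faces_def by (metis image_eqI insert_commute)
  qed
qed

section \<open>Arcs along the bounding lines\<close>

text \<open>These arcs have the outside of the strip on their left: they run rightwards along the
  top and, in \<open>bottom_arc\<close>, leftwards along the bottom.\<close>

definition top_arc :: "'a \<Rightarrow> bool" where
  "top_arc a \<longleftrightarrow> a \<in> arcs G \<and> beside (R (tail G a)) (tile (head G a, lift a)) \<and>
     yt (R (tail G a)) = D \<and> yt (R (head G a)) = D"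

definition bottom_arc :: "'a \<Rightarrow> bool" where
  "bottom_arc a \<longleftrightarrow> a \<in> arcs G \<and> beside (tile (head G a, lift a)) (R (tail G a)) \<and>
     yb (R (tail G a)) = B \<and> yb (R (head G a)) = B"

lemma top_arc_iff:
  assumes "draws a i j"
  shows "top_arc a \<longleftrightarrow> beside (tile i) (tile j) \<and> yt (tile i) = D \<and> yt (tile j) = D"
proof -
  let ?w = "(of_int (snd i) * T, 0)"
  have "tile i = translate ?w (R (tail G a))" "tile j = translate ?w (tile (head G a, lift a))"
    using assms tile_translate[of i "snd i"] tile_translate[of j "snd i"] by (simp_all only: draws_def diff_self tile_of_0)
  then have "beside (tile i) (tile j) \<longleftrightarrow> beside (R (tail G a)) (tile (head G a, lift a))"
    by (simp only: beside_translate)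
  then show ?thesis using assms by (auto simp: top_arc_def draws_def)
qed

lemma bottom_arc_iff:
  assumes "draws a i j"
  shows "bottom_arc a \<longleftrightarrow> beside (tile j) (tile i) \<and> yb (tile i) = B \<and> yb (tile j) = B"
proof -
  let ?w = "(of_int (snd i) * T, 0)"
  have "tile i = translate ?w (R (tail G a))" "tile j = translate ?w (tile (head G a, lift a))"
    using assms tile_translate[of i "snd i"] tile_translate[of j "snd i"] by (simp_all only: draws_def diff_self tile_of_0)
  then have "beside (tile j) (tile i) \<longleftrightarrow> beside (tile (head G a, lift a)) (R (tail G a))"
    by (simp only: beside_translate)
  then show ?thesis using assms by (auto simp: bottom_arc_def draws_def)
qed

text \<open>A contact on a horizontal side lies strictly inside the strip. On a vertical side the
  left end is the upper end when going right, and it has height \<open>D\<close> only if both tiles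
  reach \<open>D\<close>; symmetrically when going left.\<close>

lemma outer_arc_iff:
  assumes "a \<in> arcs G"
  shows "left_face a \<in> outer \<longleftrightarrow> top_arc a \<or> bottom_arc a"
proof -
  define i j where "i = (tail G a, 0 :: int)" and "j = (head G a, lift a)"
  have a: "draws a i j" using draws_self[OF assms, of 0] by (simp add: i_def j_def)
  note ij = drawsD[OF a]
  note bounds = tile_bounds[OF ij(1)] tile_bounds[OF ij(2)]
  have outer: "left_face a \<in> outer \<longleftrightarrow> snd (left_end (tile i) (tile j)) \<in> {B, D}"
    using outer_iff[OF assms] by (simp add: i_def j_def)
  show ?thesis
    unfolding top_arc_iff[OF a] bottom_arc_iff[OF a] outer
  proof (rule touch_cases[OF ij(6,7,8,4)])
    assume s: "stacked (tile i) (tile j)"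
    show "snd (left_end (tile i) (tile j)) \<in> {B, D} \<longleftrightarrow> beside (tile i) (tile j) \<and> yt (tile i) = D \<and> yt (tile j) = D \<or>
      beside (tile j) (tile i) \<and> yb (tile i) = B \<and> yb (tile j) = B"
      unfolding left_end_above[OF ij(6,7) s] using s bounds unfolding stacked_def beside_def by (simp only: snd_conv insert_iff empty_iff) argo
  next
    assume s: "stacked (tile j) (tile i)"
    show "snd (left_end (tile i) (tile j)) \<in> {B, D} \<longleftrightarrow> beside (tile i) (tile j) \<and> yt (tile i) = D \<and> yt (tile j) = D \<or>
      beside (tile j) (tile i) \<and> yb (tile i) = B \<and> yb (tile j) = B"
      unfolding left_end_below[OF ij(6,7) s] using s bounds unfolding stacked_def beside_def by (simp only: snd_conv insert_iff empty_iff) argo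
  next
    assume s: "beside (tile i) (tile j)"
    show "snd (left_end (tile i) (tile j)) \<in> {B, D} \<longleftrightarrow> beside (tile i) (tile j) \<and> yt (tile i) = D \<and> yt (tile j) = D \<or>
      beside (tile j) (tile i) \<and> yb (tile i) = B \<and> yb (tile j) = B"
      unfolding left_end_right[OF ij(6,7) s] using s bounds unfolding beside_def min_def by (simp only: snd_conv insert_iff empty_iff split: if_split) argo
  next
    assume s: "beside (tile j) (tile i)"
    show "snd (left_end (tile i) (tile j)) \<in> {B, D} \<longleftrightarrow> beside (tile i) (tile j) \<and> yt (tile i) = D \<and> yt (tile j) = D \<or>
      beside (tile j) (tile i) \<and> yb (tile i) = B \<and> yb (tile j) = B"
      unfolding left_end_left[OF ij(6,7) s] using s bounds unfolding beside_def max_def by (simp only: snd_conv insert_iff empty_iff split: if_split) argo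
  qed
qed

lemma not_top_and_bottom: "top_arc a \<Longrightarrow> \<not> bottom_arc a"
proof
  assume "top_arc a" "bottom_arc a"
  then have a: "draws a (tail G a, 0) (head G a, lift a)"
    using draws_self[of a 0] by (simp add: top_arc_def)
  show False
    using \<open>top_arc a\<close> \<open>bottom_arc a\<close> tile_bounds(4)[OF drawsD(1)[OF a]] tile_bounds(4)[OF drawsD(2)[OF a]]
    unfolding top_arc_iff[OF a] bottom_arc_iff[OF a] beside_def by linarith
qed

lemma draws_beside:
  assumes "i \<in> tiles" "j \<in> tiles" "beside (tile i) (tile j)"
  obtains a where "draws a i j" "draws (arev a) j i"
proof -
  have "i \<noteq> j" using assms tile_bounds(4)[OF assms(1)] by (auto simp: beside_def)
  moreover have "touch (tile i) (tile j)"
    using touch_iff[of "tile i" "tile j"] assms \<open>i \<noteq> j\<close> proper separated_tiles by blast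
  ultimately show thesis using that ex_draws_iff assms draws_arev by blast
qed

lemma draws_stacked:
  assumes "i \<in> tiles" "j \<in> tiles" "stacked (tile i) (tile j)"
  obtains a where "draws a i j" "draws (arev a) j i"
proof -
  have "i \<noteq> j" using assms tile_bounds(3)[OF assms(1)] by (auto simp: stacked_def)
  moreover have "touch (tile i) (tile j)"
    using touch_iff[of "tile i" "tile j"] assms \<open>i \<noteq> j\<close> proper separated_tiles by blast
  ultimately show thesis using that ex_draws_iff assms draws_arev by blast
qed

text \<open>Clockwise around \<open>j\<close> after its contact with \<open>i\<close>, the upper
  side carries no contact, so the next one is with the right neighbour, which also reaches the
  top.\<close>

lemma top_arc_succ:
  assumes "top_arc a"
  shows "top_arc (face_succ a)"
proof -
  define i j where "i = (tail G a, 0 :: int)" and "j = (head G a, lift a)"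
  have a: "draws a i j" using draws_self[of a 0] assms by (simp add: i_def j_def top_arc_def)
  note ij = drawsD[OF a]
  have top: "beside (tile i) (tile j)" "yt (tile i) = D" "yt (tile j) = D"
    using assms top_arc_iff[OF a] by blast+
  obtain m where m: "m \<in> tiles" "beside (tile j) (tile m)" "yt (tile j) \<le> yt (tile m)"
    using right_neighbour[OF ij(2)] by metis
  then have "yt (tile m) = D" using top(3) tile_bounds(2)[OF m(1)] by linarith
  obtain b where b: "draws b j m" using draws_beside[OF ij(2) m(1,2)] by metis
  have "rot (arev a) = b"
  proof (rule rot_eq[OF draws_arev[OF a] b])
    fix n assume n: "n \<in> tiles" "n \<noteq> j" "touch (tile j) (tile n)"
    have "\<not> stacked (tile j) (tile n)" using tile_bounds[OF n(1)] top(3) unfolding stacked_def by linarith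
    moreover have "tile i = tile n \<or> separated (tile i) (tile n)"
      using separated_tiles[OF ij(1) n(1)] by blast
    moreover have "proper_rect (tile n)" "separated (tile j) (tile n)"
      using separated_tiles[OF ij(2) n(1)] proper[OF n(1)] n(2) by blast+
    ultimately show "cw_dist (tile j) (left_end (tile j) (tile i)) (left_end (tile j) (tile m))
        \<le> cw_dist (tile j) (left_end (tile j) (tile i)) (left_end (tile j) (tile n))"
      using ij(6,7,8) n(3) top m(2) proper[OF m(1)] \<open>yt (tile m) = D\<close>
      by (intro cw_dist_top) (simp_all add: separated_sym)
  qed
  then show ?thesis
    using top_arc_iff[OF b] m(2) top(3) \<open>yt (tile m) = D\<close> by (simp add: face_succ_def)
qed

lemma bottom_arc_succ:
  assumes "bottom_arc a"
  shows "bottom_arc (face_succ a)"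
proof -
  define i j where "i = (tail G a, 0 :: int)" and "j = (head G a, lift a)"
  have a: "draws a i j" using draws_self[of a 0] assms by (simp add: i_def j_def bottom_arc_def)
  note ij = drawsD[OF a]
  have bottom: "beside (tile j) (tile i)" "yb (tile i) = B" "yb (tile j) = B"
    using assms bottom_arc_iff[OF a] by blast+
  obtain m where m: "m \<in> tiles" "beside (tile m) (tile j)" "yb (tile m) \<le> yb (tile j)"
    using left_neighbour[OF ij(2)] by metis
  then have "yb (tile m) = B" using bottom(3) tile_bounds(1)[OF m(1)] by linarith
  obtain b where b: "draws b j m" using draws_beside[OF m(1) ij(2) m(2)] by metis
  have "rot (arev a) = b"
  proof (rule rot_eq[OF draws_arev[OF a] b])
    fix n assume n: "n \<in> tiles" "n \<noteq> j" "touch (tile j) (tile n)"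
    have "\<not> stacked (tile n) (tile j)" using tile_bounds[OF n(1)] bottom(3) unfolding stacked_def by linarith
    moreover have "tile i = tile n \<or> separated (tile i) (tile n)"
      using separated_tiles[OF ij(1) n(1)] by blast
    moreover have "proper_rect (tile n)" "separated (tile j) (tile n)"
      using separated_tiles[OF ij(2) n(1)] proper[OF n(1)] n(2) by blast+
    ultimately show "cw_dist (tile j) (left_end (tile j) (tile i)) (left_end (tile j) (tile m))
        \<le> cw_dist (tile j) (left_end (tile j) (tile i)) (left_end (tile j) (tile n))"
      using ij(6,7,8) n(3) bottom m(2) proper[OF m(1)] \<open>yb (tile m) = B\<close>
      by (intro cw_dist_bottom) (simp_all add: separated_sym)
  qed
  then show ?thesis
    using bottom_arc_iff[OF b] m(2) bottom(3) \<open>yb (tile m) = B\<close> by (simp add: face_succ_def)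
qed

end

section \<open>Face orbits of the combinatorial map\<close>

context cylindrical_graph
begin

lemma face_succ_in_arcs:
  assumes "a \<in> arcs G"
  shows "face_succ a \<in> arcs G"
proof -
  have "arev a \<in> out_arcs G (head G a)" "head G a \<in> verts G" using assms by auto
  then have "cyclic_on rot (out_arcs G (head G a))" by (intro rot_cyclic) auto
  from cyclic_on_inI[OF this \<open>arev a \<in> _\<close>] show ?thesis by (simp add: face_succ_def)
qed

text \<open>On a cyclic orbit of \<open>rot\<close> every arc has a predecessor \<open>y\<close>,
  and then \<open>arev y\<close> is a preimage under \<open>face_succ\<close>.\<close>

lemma arcs_subset_face_succ: "arcs G \<subseteq> face_succ ` arcs G"
proof
  fix b assume b: "b \<in> arcs G"
  then have "b \<in> out_arcs G (tail G b)" "tail G b \<in> verts G" by auto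
  moreover from this have "cyclic_on rot (out_arcs G (tail G b))" by (intro rot_cyclic) auto
  ultimately have "b \<in> orbit rot b" and orbit: "out_arcs G (tail G b) = orbit rot b"
    by (simp_all add: cyclic_on_alldef)
  from this(1) obtain y where y: "b = rot y" "y \<in> orbit rot b"
    by (cases rule: orbit.cases) (metis \<open>b \<in> orbit rot b\<close>)+
  from y(2) have "y \<in> out_arcs G (tail G b)" by (simp only: orbit)
  then have "b = face_succ (arev y)" "arev y \<in> arcs G"
    using y(1) by (simp_all add: face_succ_def)
  then show "b \<in> face_succ ` arcs G" by (rule image_eqI)
qed

text \<open>An \<open>orbit\<close> contains its starting point only if the iteration returns to it;
  this holds because \<open>face_succ\<close> permutes the finite set of arcs.\<close>

lemma in_left_face:
  assumes "a \<in> arcs G"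
  shows "a \<in> left_face a"
proof -
  \<comment> \<open>Extended by the identity, since \<open>face_succ\<close> is controlled only on
    arcs.\<close>
  define g where "g x = (if x \<in> arcs G then face_succ x else x)" for x
  have "face_succ ` arcs G = arcs G" using arcs_subset_face_succ face_succ_in_arcs by blast
  moreover have "inj_on face_succ (arcs G)"
    using finite_surj_inj[OF finite_arcs arcs_subset_face_succ] .
  ultimately have "bij_betw g (arcs G) (arcs G)"
    by (auto simp: bij_betw_def g_def inj_on_def)
  then have "g permutes arcs G" by (rule bij_imp_permutes) (simp add: g_def)
  then have "permutation g" using permutation_permutes finite_arcs by blast
  then have "a \<in> orbit g a" by (rule permutation_self_in_orbit)
  also have "orbit g a = orbit face_succ a"
    by (rule orbit_cong0[OF assms]) (auto simp: g_def face_succ_in_arcs)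
  finally show ?thesis by (simp add: left_face_def)
qed

lemma left_face_induct:
  assumes "b \<in> left_face a" "P a" "\<And>x. P x \<Longrightarrow> P (face_succ x)"
  shows "P b"
  using assms(1) unfolding left_face_def by induction (use assms in auto)

lemma outer_left_face:
  assumes "f \<in> outer"
  obtains a where "a \<in> arcs G" "f = left_face a"
  using outer_faces assms by (auto simp: left_face_def face_succ_def)

end

section \<open>The two outer faces\<close>

context horizontal_dual
begin

lemma outer_face_cases:
  assumes "f \<in> outer"
  obtains a where "f = left_face a" "top_arc a" "\<And>b. b \<in> f \<Longrightarrow> top_arc b"
  | a where "f = left_face a" "bottom_arc a" "\<And>b. b \<in> f \<Longrightarrow> bottom_arc b"
proof -
  obtain a where a: "a \<in> arcs G" "f = left_face a" using outer_left_face assms by blast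
  then have "top_arc a \<or> bottom_arc a" using outer_arc_iff assms by blast
  then show thesis
    using that a(2) left_face_induct[of _ a top_arc] left_face_induct[of _ a bottom_arc]
      top_arc_succ bottom_arc_succ by blast
qed

text \<open>Two tiles that both adjoin the right side of the same tile and both reach the top would
  overlap.\<close>

lemma top_arc_unique:
  assumes "top_arc a" "top_arc b" "tail G a = tail G b"
  shows "a = b"
proof -
  have a: "draws a (tail G a, 0) (head G a, lift a)" and b: "draws b (tail G a, 0) (head G b, lift b)"
    using draws_self[of a 0] draws_self[of b 0] assms by (auto simp: top_arc_def)
  have "\<not> separated (tile (head G a, lift a)) (tile (head G b, lift b))"
    using assms tile_bounds[OF drawsD(2)[OF a]] tile_bounds[OF drawsD(2)[OF b]]
    unfolding top_arc_iff[OF a] top_arc_iff[OF b] beside_def separated_def by linarith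
  then have "(head G a, lift a) = (head G b, lift b)"
    using separated_tiles drawsD(2)[OF a] drawsD(2)[OF b] by blast
  then show ?thesis using draws_unique a b by metis
qed

lemma bottom_arc_unique:
  assumes "bottom_arc a" "bottom_arc b" "tail G a = tail G b"
  shows "a = b"
proof -
  have a: "draws a (tail G a, 0) (head G a, lift a)" and b: "draws b (tail G a, 0) (head G b, lift b)"
    using draws_self[of a 0] draws_self[of b 0] assms by (auto simp: bottom_arc_def)
  have "\<not> separated (tile (head G a, lift a)) (tile (head G b, lift b))"
    using assms tile_bounds[OF drawsD(2)[OF a]] tile_bounds[OF drawsD(2)[OF b]]
    unfolding bottom_arc_iff[OF a] bottom_arc_iff[OF b] beside_def separated_def by linarith
  then have "(head G a, lift a) = (head G b, lift b)"
    using separated_tiles drawsD(2)[OF a] drawsD(2)[OF b] by blast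
  then show ?thesis using draws_unique a b by metis
qed

lemma ex_top_arc:
  assumes "v \<in> verts G" "yt (R v) = D"
  obtains a where "top_arc a" "tail G a = v"
proof -
  have i: "(v, 0) \<in> tiles" using assms by simp
  obtain j where j: "j \<in> tiles" "beside (tile (v, 0)) (tile j)" "yt (tile (v, 0)) \<le> yt (tile j)"
    using right_neighbour[OF i] by metis
  obtain a where a: "draws a (v, 0) j" using draws_beside[OF i j(1,2)] by metis
  have "yt (tile j) = D" using j(3) assms(2) tile_bounds(2)[OF j(1)] by simp
  then have "top_arc a" using top_arc_iff[OF a] j(2) assms(2) by simp
  then show thesis using that a by (simp add: draws_def)
qed

lemma ex_bottom_arc:
  assumes "v \<in> verts G" "yb (R v) = B"
  obtains a where "bottom_arc a" "tail G a = v"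
proof -
  have i: "(v, 0) \<in> tiles" using assms by simp
  obtain j where j: "j \<in> tiles" "beside (tile j) (tile (v, 0))" "yb (tile j) \<le> yb (tile (v, 0))"
    using left_neighbour[OF i] by metis
  obtain a where a: "draws a (v, 0) j" using draws_beside[OF j(1) i j(2)] by metis
  have "yb (tile j) = B" using j(3) assms(2) tile_bounds(1)[OF j(1)] by simp
  then have "bottom_arc a" using bottom_arc_iff[OF a] j(2) assms(2) by simp
  then show thesis using that a by (simp add: draws_def)
qed

lemma B_less_D: "B < D"
proof -
  obtain f where "f \<in> outer" using two_outer_faces by fastforce
  then obtain a where "a \<in> arcs G" using outer_left_face by blast
  then have "(tail G a, 0) \<in> tiles" by auto
  from tile_bounds[OF this] show ?thesis by linarith
qed

lemma top_and_bottom_arcs: "\<exists>a. top_arc a" "\<exists>a. bottom_arc a"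
proof -
  obtain i where i: "i \<in> tiles" "quad 2 (tile i) (0, D)"
    using B_less_D by (auto intro: quad_exists[of "(0, D)" 2])
  then have "yt (R (fst i)) = D" using tile_bounds(2)[OF i(1)] by (simp add: quad_def)
  moreover have "fst i \<in> verts G" using i(1) by auto
  ultimately show "\<exists>a. top_arc a" using ex_top_arc by metis
next
  obtain i where i: "i \<in> tiles" "quad 0 (tile i) (0, B)"
    using B_less_D by (auto intro: quad_exists[of "(0, B)" 0])
  then have "yb (R (fst i)) = B" using tile_bounds(1)[OF i(1)] by (simp add: quad_def)
  moreover have "fst i \<in> verts G" using i(1) by auto
  ultimately show "\<exists>a. bottom_arc a" using ex_bottom_arc by metis
qed

lemma top_bottom_faces_distinct:
  assumes "top_arc a" "bottom_arc b"
  shows "left_face a \<noteq> left_face b"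
proof
  assume "left_face a = left_face b"
  then have "a \<in> left_face b" using in_left_face assms by (auto simp: top_arc_def)
  then have "bottom_arc a" using left_face_induct[of a b bottom_arc] bottom_arc_succ assms by blast
  then show False using not_top_and_bottom assms by blast
qed

text \<open>A counting argument: there are only two outer faces, and top and bottom arcs already
  give two. Hence all top arcs lie in one face without tracing the top row, and likewise all bottom
  arcs.\<close>

lemma outer_eq:
  assumes "top_arc a" "bottom_arc b"
  shows "outer = {left_face a, left_face b}"
proof -
  have "{left_face a, left_face b} \<subseteq> outer"
    using outer_arc_iff assms by (auto simp: top_arc_def bottom_arc_def)
  moreover have "card {left_face a, left_face b} = 2"
    using top_bottom_faces_distinct[OF assms] by simp
  moreover have "finite outer" using two_outer_faces by (metis card.infinite zero_neq_numeral)
  ultimately show ?thesis using two_outer_faces card_subset_eq by metis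
qed

lemma same_top_face: "top_arc a \<Longrightarrow> top_arc b \<Longrightarrow> left_face a = left_face b"
  using outer_eq top_and_bottom_arcs(2) top_bottom_faces_distinct by (metis doubleton_eq_iff)

lemma same_bottom_face: "bottom_arc a \<Longrightarrow> bottom_arc b \<Longrightarrow> left_face a = left_face b"
  using outer_eq top_and_bottom_arcs(1) top_bottom_faces_distinct by (metis doubleton_eq_iff)

lemma outer_face_tail_unique:
  assumes "f \<in> outer" "a \<in> f" "b \<in> f" "tail G a = tail G b"
  shows "a = b"
  using outer_face_cases[OF assms(1)] top_arc_unique bottom_arc_unique assms(2-4) by metis

text \<open>Two touching tiles that reach the same bounding line are side by side, so the arc or its
  reverse runs along that line and lies in \<open>f\<close>.\<close>

lemma outer_face_no_chord:
  assumes "f \<in> outer"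
  shows "\<not> chord f a"
proof
  assume "chord f a"
  then have a: "a \<in> arcs G" "a \<notin> f" "arev a \<notin> f" and
    verts: "tail G a \<in> tail G ` f" "head G a \<in> tail G ` f"
    by (auto simp: chord_def face_verts_def)
  define i j where "i = (tail G a, 0 :: int)" and "j = (head G a, lift a)"
  have ij: "draws a i j" using draws_self[OF a(1), of 0] by (simp add: i_def j_def)
  note ji = draws_arev[OF ij]
  note bounds = tile_bounds[OF drawsD(1)[OF ij]] tile_bounds[OF drawsD(2)[OF ij]]
  note cases = touch_cases[OF drawsD(6,7,8,4)[OF ij]]
  from assms show False
  proof (cases rule: outer_face_cases)
    case (1 c)
    then have "yt (tile i) = D" "yt (tile j) = D" using verts by (auto simp: top_arc_def i_def j_def)
    then have "top_arc a \<or> top_arc (arev a)"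
      unfolding top_arc_iff[OF ij] top_arc_iff[OF ji] using bounds
      by (rule_tac cases) (auto simp: stacked_def)
    then show False using same_top_face 1 in_left_face a arev_in_arcs by metis
  next
    case (2 c)
    then have "yb (tile i) = B" "yb (tile j) = B" using verts by (auto simp: bottom_arc_def i_def j_def)
    then have "bottom_arc a \<or> bottom_arc (arev a)"
      unfolding bottom_arc_iff[OF ij] bottom_arc_iff[OF ji] using bounds
      by (rule_tac cases) (auto simp: stacked_def)
    then show False using same_bottom_face 2 in_left_face a arev_in_arcs by metis
  qed
qed

section \<open>Degree bounds\<close>

definition up_arcs :: "'v \<Rightarrow> 'a set" where
  "up_arcs v = {a \<in> out_arcs G v. stacked (R v) (tile (head G a, lift a))}"

definition down_arcs :: "'v \<Rightarrow> 'a set" where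
  "down_arcs v = {a \<in> out_arcs G v. stacked (tile (head G a, lift a)) (R v)}"

text \<open>The summand 2 stands for a left and a right neighbour, which every tile has.\<close>

lemma out_degree_ge:
  assumes "v \<in> verts G"
  shows "card (up_arcs v) + card (down_arcs v) + 2 \<le> out_degree G v"
proof -
  have v: "(v, 0) \<in> tiles" using assms by simp
  note bounds = tile_bounds[OF v]
  obtain l where l: "l \<in> tiles" "beside (tile l) (tile (v, 0))" using left_neighbour[OF v] by metis
  obtain r where r: "r \<in> tiles" "beside (tile (v, 0)) (tile r)" using right_neighbour[OF v] by metis
  obtain a where a: "draws a (v, 0) l" using draws_beside[OF l(1) v l(2)] by metis
  obtain b where b: "draws b (v, 0) r" using draws_beside[OF v r] by metis
  have "l = (head G a, lift a)" "r = (head G b, lift b)"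
    using a b by (auto simp: draws_def prod_eq_iff)
  moreover have "up_arcs v \<inter> down_arcs v = {}"
  proof (rule ccontr)
    assume "up_arcs v \<inter> down_arcs v \<noteq> {}"
    then obtain c where "c \<in> up_arcs v" "c \<in> down_arcs v" by blast
    then show False
      using bounds tile_bounds[of "(head G c, 0)"] by (auto simp: up_arcs_def down_arcs_def stacked_def)
  qed
  \<comment> \<open>Even if \<open>l\<close> and \<open>r\<close> are translates of one rectangle,
    they are different tiles, so their arcs differ.\<close>
  ultimately have "{a, b} \<inter> (up_arcs v \<union> down_arcs v) = {}" "a \<noteq> b" "up_arcs v \<inter> down_arcs v = {}"
    using l(2) r(2) bounds tile_bounds[OF l(1)] by (auto simp: up_arcs_def down_arcs_def stacked_def beside_def)
  moreover have "finite (up_arcs v)" "finite (down_arcs v)"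
    by (auto simp: up_arcs_def down_arcs_def out_arcs_def)
  ultimately have "card ({a, b} \<union> (up_arcs v \<union> down_arcs v)) = card (up_arcs v) + card (down_arcs v) + 2"
    by (simp add: card_Un_disjoint)
  moreover have "{a, b} \<union> (up_arcs v \<union> down_arcs v) \<subseteq> out_arcs G v"
    using a b by (auto simp: draws_def up_arcs_def down_arcs_def)
  moreover have "finite (out_arcs G v)" by (simp add: out_arcs_def)
  ultimately show ?thesis unfolding out_degree_def by (metis card_mono)
qed

lemma card_up_arcs_pos:
  assumes "v \<in> verts G" "yt (R v) < D"
  shows "1 \<le> card (up_arcs v)"
proof -
  have v: "(v, 0) \<in> tiles" using assms by simp
  obtain j where j: "j \<in> tiles" "stacked (tile (v, 0)) (tile j)" using upper_neighbour[OF v] assms(2) by auto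
  obtain a where a: "draws a (v, 0) j" using draws_stacked[OF v j] by metis
  then have "j = (head G a, lift a)" by (auto simp: draws_def prod_eq_iff)
  then have "a \<in> up_arcs v" using a j by (auto simp: up_arcs_def draws_def)
  moreover have "finite (up_arcs v)" by (simp add: up_arcs_def out_arcs_def)
  ultimately have "card (up_arcs v) \<noteq> 0" by auto
  then show ?thesis by linarith
qed

lemma card_down_arcs_pos:
  assumes "v \<in> verts G" "B < yb (R v)"
  shows "1 \<le> card (down_arcs v)"
proof -
  have v: "(v, 0) \<in> tiles" using assms by simp
  obtain j where j: "j \<in> tiles" "stacked (tile j) (tile (v, 0))" using lower_neighbour[OF v] assms(2) by auto
  obtain a where a: "draws a (v, 0) j" using draws_stacked[OF j(1) v j(2)] by metis
  then have "j = (head G a, lift a)" by (auto simp: draws_def prod_eq_iff)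
  then have "a \<in> down_arcs v" using a j by (auto simp: down_arcs_def draws_def)
  moreover have "finite (down_arcs v)" by (simp add: down_arcs_def out_arcs_def)
  ultimately have "card (down_arcs v) \<noteq> 0" by auto
  then show ?thesis by linarith
qed

text \<open>The loop makes the width a nonzero multiple of \<open>T\<close>, and disjointness from
  the next translate bounds it by \<open>T\<close>.\<close>

lemma looped_width:
  assumes "has_loop v"
  shows "v \<in> verts G" "xr (R v) = xl (R v) + T"
proof -
  obtain a where a: "a \<in> arcs G" "tail G a = v" "head G a = v"
    using assms unfolding has_loop_def by blast
  then show v: "v \<in> verts G" by auto
  have "\<bar>of_int (lift a)\<bar> * T = xr (R v) - xl (R v)"
    using lift_between_translates[OF draws_self[OF a(1), of 0]] a by simp
  moreover have "1 \<le> \<bar>real_of_int (lift a)\<bar>" using loop_lift_nonzero[OF a(1)] a by simp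
  then have "1 * T \<le> \<bar>of_int (lift a)\<bar> * T" using T_pos by (intro mult_right_mono) auto
  moreover have "separated (tile (v, 0)) (tile (v, 1))" using v by (intro separated_tiles) auto
  then have "xr (R v) \<le> xl (R v) + T"
    using tile_bounds[of "(v, 0)"] v T_pos by (auto simp: separated_def)
  ultimately show "xr (R v) = xl (R v) + T" by linarith
qed

text \<open>The translates of a looped rectangle fill a horizontal band, and bands of different
  vertices cannot overlap.\<close>

lemma looped_overlap:
  assumes "has_loop v" "has_loop w" "yb (R v) < yt (R w)" "yb (R w) < yt (R v)"
  shows "v = w"
proof -
  \<comment> \<open>Selects the translate of \<open>R w\<close> whose horizontal extent contains the
    left border of \<open>R v\<close>.\<close>
  define k where "k = \<lfloor>(xl (R v) - xl (R w)) / T\<rfloor>"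
  have "of_int k \<le> (xl (R v) - xl (R w)) / T" "(xl (R v) - xl (R w)) / T < of_int k + 1"
    by (simp_all add: k_def)
  then have k: "of_int k * T \<le> xl (R v) - xl (R w)" "xl (R v) - xl (R w) < of_int k * T + T"
    using T_pos by (simp_all add: field_simps)
  have "\<not> separated (tile (v, 0)) (tile (w, k))"
    using looped_width[OF assms(1)] looped_width[OF assms(2)] assms(3,4) k T_pos by (auto simp: separated_def)
  then have "(v, 0) = (w, k)"
    using separated_tiles[of "(v, 0)" "(w, k)"] looped_width(1)[OF assms(1)] looped_width(1)[OF assms(2)] by auto
  then show ?thesis by simp
qed

text \<open>A tile beside a looped one would overlap the adjacent translate in the band of the
  latter.\<close>

lemma looped_neighbour_stacked:
  assumes "a \<in> arcs G" "tail G a \<noteq> head G a" "has_loop (head G a)"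
  shows "a \<in> up_arcs (tail G a) \<or> a \<in> down_arcs (tail G a)"
proof -
  define i j where "i = (tail G a, 0 :: int)" and "j = (head G a, lift a)"
  have a: "draws a i j" using draws_self[OF assms(1), of 0] by (simp add: i_def j_def)
  note ij = drawsD[OF a]
  note bounds = tile_bounds[OF ij(1)] tile_bounds[OF ij(2)]
  have width: "xr (R (head G a)) = xl (R (head G a)) + T" using looped_width[OF assms(3)] by simp
  have sep: "separated (tile i) (tile (head G a, k))" for k
    using ij(1,2) assms(2) by (intro separated_tiles) (auto simp: i_def j_def)
  show ?thesis
  proof (rule touch_cases[OF ij(6,7,8,4)])
    assume "beside (tile i) (tile j)"
    then show ?thesis
      using sep[of "lift a - 1"] bounds width T_pos by (auto simp: beside_def separated_def j_def algebra_simps)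
  next
    assume "beside (tile j) (tile i)"
    then show ?thesis
      using sep[of "lift a + 1"] bounds width T_pos by (auto simp: beside_def separated_def j_def algebra_simps)
  qed (use assms(1) in \<open>auto simp: up_arcs_def down_arcs_def i_def j_def\<close>)
qed

text \<open>Both parallel arcs leave through the same side of \<open>R u\<close>: since rectangles
  have positive height, \<open>R v\<close> cannot adjoin it both above and below.\<close>

lemma parallel_looped_neighbour:
  assumes "parallel_neighbor u v" "has_loop v"
  shows "2 \<le> card (up_arcs u) \<and> yb (R v) = yt (R u) \<or> 2 \<le> card (down_arcs u) \<and> yt (R v) = yb (R u)"
proof -
  obtain a b where ab: "a \<in> arcs G" "b \<in> arcs G" "a \<noteq> b" "tail G a = u" "head G a = v" "tail G b = u" "head G b = v" "u \<noteq> v"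
    using assms(1) unfolding parallel_neighbor_def parallel_def by metis
  then have *: "a \<in> up_arcs u \<or> a \<in> down_arcs u" "b \<in> up_arcs u \<or> b \<in> down_arcs u"
    using looped_neighbour_stacked[of a] looped_neighbour_stacked[of b] assms(2) by auto
  have "u \<in> verts G" "v \<in> verts G" using ab by auto
  then have y: "yb (R u) < yt (R u)" "yb (R v) < yt (R v)"
    using tile_bounds(3)[of "(u, 0)"] tile_bounds(3)[of "(v, 0)"] by auto
  have up: "yb (R v) = yt (R u)" if "c \<in> up_arcs u" "head G c = v" for c
    using that by (simp add: up_arcs_def stacked_def)
  have down: "yt (R v) = yb (R u)" if "c \<in> down_arcs u" "head G c = v" for c
    using that by (simp add: down_arcs_def stacked_def)
  have card: "2 \<le> card S" if "{a, b} \<subseteq> S" "finite S" for S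
    using card_mono[OF that(2,1)] ab(3) by simp
  have fin: "finite (up_arcs u)" "finite (down_arcs u)"
    by (auto simp: up_arcs_def down_arcs_def out_arcs_def)
  from *(1) show ?thesis
  proof
    assume a: "a \<in> up_arcs u"
    then have "b \<in> up_arcs u" using *(2) up[of a] down[of b] ab y by auto
    then show ?thesis using a up[of a] ab card[of "up_arcs u"] fin by simp
  next
    assume a: "a \<in> down_arcs u"
    then have "b \<in> down_arcs u" using *(2) up[of b] down[of a] ab y by auto
    then show ?thesis using a down[of a] ab card[of "down_arcs u"] fin by simp
  qed
qed

lemma parallel_neighbor_in_verts: "parallel_neighbor u v \<Longrightarrow> u \<in> verts G"
  unfolding parallel_neighbor_def parallel_def by auto

lemma not_outer_inside:
  assumes "v \<in> verts G" "\<And>f. f \<in> outer \<Longrightarrow> v \<notin> face_verts f"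
  shows "yt (R v) < D" "B < yb (R v)"
proof -
  have "(v, 0) \<in> tiles" using assms(1) by simp
  note bounds = tile_bounds(1,2)[OF this]
  have no_arc: "\<not> top_arc a" "\<not> bottom_arc a" if "tail G a = v" for a
    using that assms(2)[of "left_face a"] outer_arc_iff[of a] in_left_face[of a]
    by (auto simp: face_verts_def top_arc_def bottom_arc_def)
  have "yt (R v) \<noteq> D" "yb (R v) \<noteq> B"
    using ex_top_arc[OF assms(1)] ex_bottom_arc[OF assms(1)] no_arc by metis+
  then show "yt (R v) < D" "B < yb (R v)" using bounds by auto
qed

section \<open>The PTC conditions\<close>

lemma PTC: "PTC_graph G arev rot outer"
proof (unfold_locales, goal_cases)
  case (1 f)
  then show ?case by (rule inner_faceD)
next
  case (2 a)
  then show ?case using contractible_sum_lift[of "[a]"] loop_lift_nonzero by auto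
next
  case (3 a b)
  then have "b \<in> arcs G" by (simp add: parallel_def)
  then show ?case
    using contractible_sum_lift[of "[a, arev b]"] parallel_lift_neq[OF 3] lift_arev[of b] by auto
next
  case (4 a b c)
  then show ?case
    using contractible_sum_lift[of "[a, b, c]"] triangle_face[of a b c] by (auto simp: separating_triangle_def)
next
  case (5 f a b)
  then show ?case using outer_face_tail_unique by metis
next
  case (6 f a)
  then show ?case by (rule outer_face_no_chord)
next
  case (7 u v f)
  \<comment> \<open>Two contacts on one horizontal side, plus one on the left and one on the
    right.\<close>
  then show ?case
    using out_degree_ge[OF parallel_neighbor_in_verts[OF 7(1)]] parallel_looped_neighbour[OF 7(1,2)] by auto
next
  case (8 u v w)
  \<comment> \<open>Two looped neighbours on the same side of \<open>R u\<close> would overlap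
    vertically, so each horizontal side of \<open>R u\<close> has two contacts.\<close>
  have "\<not> (yb (R v) = yt (R u) \<and> yb (R w) = yt (R u))" "\<not> (yt (R v) = yb (R u) \<and> yt (R w) = yb (R u))"
    using looped_overlap[OF 8(2,4)] 8(5) tile_bounds(3)[of "(v, 0)"] tile_bounds(3)[of "(w, 0)"]
      looped_width(1)[OF 8(2)] looped_width(1)[OF 8(4)] by auto
  then have "2 \<le> card (up_arcs u)" "2 \<le> card (down_arcs u)"
    using parallel_looped_neighbour[OF 8(1,2)] parallel_looped_neighbour[OF 8(3,4)] by auto
  then show ?case using out_degree_ge[OF parallel_neighbor_in_verts[OF 8(1)]] by linarith
next
  case (9 u v)
  have u: "u \<in> verts G" using parallel_neighbor_in_verts[OF 9(1)] .
  \<comment> \<open>The horizontal side facing away from \<open>R v\<close> has a contact too,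
    because \<open>R u\<close> stays clear of both bounding lines.\<close>
  have "1 \<le> card (up_arcs u)" "1 \<le> card (down_arcs u)"
    using card_up_arcs_pos card_down_arcs_pos not_outer_inside u 9(3) by blast+
  then show ?case using out_degree_ge[OF u] parallel_looped_neighbour[OF 9(1,2)] by linarith
qed

end

section \<open>Reduction to a horizontal strip\<close>

lemma UN_times_UNIV: "(\<Union>i\<in>A \<times> UNIV. h (fst i) (snd i)) = (\<Union>v\<in>A. \<Union>k. h v k)"
  by (auto; blast)

lemma slanted_strip_not_tiled:
  fixes tile :: "'i \<Rightarrow> rect" and t :: "real \<times> real"
  assumes "countable I" "0 < fst t" "c \<le> d"
    and strip: "(\<Union>i\<in>I. region (tile i)) =
      {p. c \<le> fst t * snd p - snd t * fst p \<and> fst t * snd p - snd t * fst p \<le> d}"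
  shows "snd t = 0"
proof (rule ccontr)
  assume t: "snd t \<noteq> 0"
  define g where "g p = fst t * snd p - snd t * fst p" for p
  \<comment> \<open>The point with first coordinate \<open>x\<close> on the bounding line where
    \<open>g\<close> equals \<open>d\<close>.\<close>
  define q where "q x = (x, (d + snd t * x) / fst t)" for x
  have gq: "g (q x) = d" for x using assms(2) by (simp add: g_def q_def)
  have tile_le: "g p \<le> d" if "i \<in> I" "p \<in> region (tile i)" for i p
    using that strip unfolding g_def by blast
  have "\<exists>i\<in>I. q x \<in> region (tile i)" for x
    using strip gq[of x] assms(3) unfolding g_def by blast
  then obtain i where i: "i x \<in> I" "q x \<in> region (tile (i x))" for x by metis
  have no_less: "i x \<noteq> i y" if "x < y" for x y
  proof
    assume "i x = i y"
    then have "q x \<in> region (tile (i x))" "q y \<in> region (tile (i x))" using i by metis+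
    \<comment> \<open>A tile containing two points of the line contains the other two corners of the
      box they span, and at one of these \<open>g\<close> exceeds \<open>d\<close>.\<close>
    then have r: "(fst (q x), snd (q y)) \<in> region (tile (i x))" "(fst (q y), snd (q x)) \<in> region (tile (i x))"
      by (auto simp: mem_region)
    from tile_le[OF i(1) r(1)] tile_le[OF i(1) r(2)]
    have "g (fst (q x), snd (q y)) \<le> d" "g (fst (q y), snd (q x)) \<le> d" by auto
    moreover have "fst t * snd (q z) = d + snd t * z" for z
      using assms(2) by (simp add: q_def)
    then have "g (fst (q x), snd (q y)) = d + snd t * (y - x)" "g (fst (q y), snd (q x)) = d - snd t * (y - x)"
      by (simp_all add: g_def) (simp_all add: q_def right_diff_distrib)
    moreover have "snd t * (y - x) \<noteq> 0" using t that by simp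
    ultimately show False by linarith
  qed
  have "inj i"
  proof (rule injI)
    fix x y assume "i x = i y"
    then show "x = y" using no_less[of x y] no_less[of y x] by (metis less_linear)
  qed
  moreover have "countable (range i)" using i(1) assms(1) by (auto intro: countable_subset)
  ultimately have "countable (UNIV :: real set)" using countable_image_inj_on by blast
  then show False using uncountable_UNIV_real by blast
qed

lemma frontier_horizontal_strip:
  fixes B D :: real
  assumes "B \<le> D"
  shows "frontier {p :: real \<times> real. B \<le> snd p \<and> snd p \<le> D} = {p. snd p \<in> {B, D}}"
proof -
  have *: "{p :: real \<times> real. B \<le> snd p \<and> snd p \<le> D} = UNIV \<times> {B..D}" by auto
  have "UNIV \<times> {B..D} - UNIV \<times> {B<..<D} = {p :: real \<times> real. snd p \<in> {B, D}}"
    using assms by force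
  then show ?thesis
    unfolding * frontier_def by (simp add: closure_Times interior_Times)
qed

context cylindrical_graph
begin

lemma rectangular_dual_PTC:
  assumes "rectangular_dual t R lift"
  shows "PTC_graph G arev rot outer"
proof -
  note dual = assms[unfolded rectangular_dual_def Let_def]
  have T: "0 < fst t" and proper: "\<And>v. v \<in> verts G \<Longrightarrow> proper_rect (R v)"
    using conjunct1[OF dual] bspec[OF conjunct1[OF conjunct2[OF dual]]] .
  obtain c d where strip: "(\<Union>v\<in>verts G. \<Union>k. region (translate (of_int k *\<^sub>R t) (R v))) =
      {p. c \<le> fst t * snd p - snd t * fst p \<and> fst t * snd p - snd t * fst p \<le> d}"
    using dual[THEN conjunct2, THEN conjunct2, THEN conjunct2, THEN conjunct2, THEN conjunct1] by (elim exE)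
  \<comment> \<open>An outer face yields an arc and hence a vertex, so the strip is nonempty and
    \<open>c \<le> d\<close>.\<close>
  obtain f where "f \<in> outer" using two_outer_faces by fastforce
  then obtain a where "a \<in> arcs G" using outer_left_face by blast
  then have v: "tail G a \<in> verts G" by simp
  then have "fst (R (tail G a)) \<in> region (translate (of_int 0 *\<^sub>R t) (R (tail G a)))"
    using proper[OF v] by (auto simp: mem_region proper_rect_def)
  then have "fst (R (tail G a)) \<in> (\<Union>v\<in>verts G. \<Union>k. region (translate (of_int k *\<^sub>R t) (R v)))"
    by (rule UN_I[OF v UN_I[OF UNIV_I]])
  then have "c \<le> d" unfolding strip by auto
  have "snd t = 0"
  proof (rule slanted_strip_not_tiled)
    show "countable (verts G \<times> (UNIV :: int set))"
      using countable_finite[OF finite_verts] by (intro countable_SIGMA) simp_all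
    show "(\<Union>i\<in>verts G \<times> UNIV. region (translate (of_int (snd i) *\<^sub>R t) (R (fst i)))) =
        {p. c \<le> fst t * snd p - snd t * fst p \<and> fst t * snd p - snd t * fst p \<le> d}"
      unfolding strip[symmetric] by (rule UN_times_UNIV)
  qed (use T \<open>c \<le> d\<close> in auto)
  define B D where "B = c / fst t" and "D = d / fst t"
  have "B \<le> D" using \<open>c \<le> d\<close> T by (simp add: B_def D_def divide_right_mono)
  have "of_int k *\<^sub>R t = (of_int k * fst t, 0)" for k
    using \<open>snd t = 0\<close> by (simp add: prod_eq_iff)
  then have tile: "translate (of_int k *\<^sub>R t) (R v) = tile_of (fst t) R (v, k)" for v k
    by (simp add: tile_of_def)
  have union: "(\<Union>v\<in>verts G. \<Union>k. region (tile_of (fst t) R (v, k))) = {p. B \<le> snd p \<and> snd p \<le> D}"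
    using strip T unfolding tile by (simp add: \<open>snd t = 0\<close> B_def D_def field_simps)
  have frontier: "frontier (\<Union>v\<in>verts G. \<Union>k. region (tile_of (fst t) R (v, k))) = {p. snd p \<in> {B, D}}"
    unfolding union by (rule frontier_horizontal_strip[OF \<open>B \<le> D\<close>])
  note dual' = dual[unfolded tile frontier, THEN conjunct2, THEN conjunct2]
  note disjoint_interiors = conjunct1[OF dual'] and dual' = conjunct2[OF dual']
  \<comment> \<open>The second \<open>conjunct2\<close> passes over the strip condition, which
    \<open>strip\<close> has already extracted.\<close>
  note no_four_tiles = conjunct1[OF dual'] and dual' = conjunct2[OF conjunct2[OF dual']]
  note contact_arcs = conjunct1[OF dual'] and dual' = conjunct2[OF dual']
  note lift_rev = conjunct1[OF dual'] and dual' = conjunct2[OF dual']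
  note rot_min = conjunct1[OF dual'] and outer_arcs = conjunct2[OF dual']
  have proper_tile: "proper_rect (tile_of (fst t) R i)" if "i \<in> verts G \<times> UNIV" for i
    using that proper by (auto simp: tile_of_def proper_translate)
  have disjoint: "(u, j) \<noteq> (v, k) \<Longrightarrow>
      interior (region (tile_of (fst t) R (u, j))) \<inter> interior (region (tile_of (fst t) R (v, k))) = {}"
    if "u \<in> verts G" "v \<in> verts G" for u v j k
    using disjoint_interiors that by blast
  interpret strip_tiling "verts G \<times> (UNIV :: int set)" "tile_of (fst t) R" B D
  proof
    show "proper_rect (tile_of (fst t) R i)" if "i \<in> verts G \<times> UNIV" for i
      using that by (rule proper_tile)
    show "separated (tile_of (fst t) R i) (tile_of (fst t) R j)"
      if "i \<in> verts G \<times> UNIV" "j \<in> verts G \<times> UNIV" "i \<noteq> j" for i j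
      using that disjoint[of "fst i" "fst j" "snd i" "snd j"] separated_iff[OF proper_tile proper_tile] by auto
    show "(\<Union>i\<in>verts G \<times> UNIV. region (tile_of (fst t) R i)) = {p. B \<le> snd p \<and> snd p \<le> D}"
      unfolding union[symmetric] UN_times_UNIV[of "\<lambda>v k. region (tile_of (fst t) R (v, k))", symmetric] prod.collapse ..
    show "finite {i \<in> verts G \<times> UNIV. xl (tile_of (fst t) R i) \<le> b \<and> a \<le> xr (tile_of (fst t) R i)}" for a b
    proof (rule finite_subset)
      \<comment> \<open>For each vertex the admissible shifts form a bounded interval of
        integers.\<close>
      show "{i \<in> verts G \<times> UNIV. xl (tile_of (fst t) R i) \<le> b \<and> a \<le> xr (tile_of (fst t) R i)}
          \<subseteq> (SIGMA v:verts G. {\<lceil>(a - xr (R v)) / fst t\<rceil>..\<lfloor>(b - xl (R v)) / fst t\<rfloor>})"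
        using T by (auto simp: ceiling_le_iff le_floor_iff field_simps)
    qed simp
    show "card S \<noteq> 4" if "S \<subseteq> {i \<in> verts G \<times> UNIV. p \<in> region (tile_of (fst t) R i)}" for S p
    proof -
      have "{i \<in> verts G \<times> UNIV. p \<in> region (tile_of (fst t) R i)} =
          {(v, k). v \<in> verts G \<and> p \<in> region (tile_of (fst t) R (v, k))}" by auto
      with that have "S \<subseteq> {(v, k). v \<in> verts G \<and> p \<in> region (tile_of (fst t) R (v, k))}"
        by (simp only:)
      then show ?thesis using spec[OF no_four_tiles, of p] by blast
    qed
  qed
  interpret horizontal_dual G arev rot outer "fst t" R B D lift
  proof
    show "0 < fst t" by (rule T)
    show "bij_betw (\<lambda>a. (tail G a, head G a, lift a)) (arcs G)
      {(u, v, k). u \<in> verts G \<and> v \<in> verts G \<and> (u, 0) \<noteq> (v, k) \<and> touch (R u) (tile_of (fst t) R (v, k))}"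
      by (rule contact_arcs)
    show "lift (arev a) = - lift a" if "a \<in> arcs G" for a
      using lift_rev that by blast
    show "cw_dist (R (tail G a)) (left_end (R (tail G a)) (tile_of (fst t) R (head G a, lift a)))
        (left_end (R (tail G (rot a))) (tile_of (fst t) R (head G (rot a), lift (rot a))))
      \<le> cw_dist (R (tail G a)) (left_end (R (tail G a)) (tile_of (fst t) R (head G a, lift a)))
        (left_end (R (tail G b)) (tile_of (fst t) R (head G b, lift b)))"
      if "a \<in> arcs G" "b \<in> out_arcs G (tail G a)" for a b
      using bspec[OF bspec[OF rot_min that(1)] that(2)] .
    show "left_face a \<in> outer \<longleftrightarrow>
        snd (left_end (R (tail G a)) (tile_of (fst t) R (head G a, lift a))) \<in> {B, D}"
      if "a \<in> arcs G" for a
    proof -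
      have "left_face a \<in> outer \<longleftrightarrow>
          left_end (R (tail G a)) (tile_of (fst t) R (head G a, lift a)) \<in> {p. snd p \<in> {B, D}}"
        using bspec[OF outer_arcs that] .
      then show ?thesis by simp
    qed
  qed
  show ?thesis by (rule PTC)
qed

end

theorem lemma6:
  fixes G :: "('v, 'a) pre_digraph"
    and arev :: "'a \<Rightarrow> 'a"
    and rot :: "'a \<Rightarrow> 'a"
    and outer :: "'a set set"
  assumes "cylindrical_graph G arev rot outer"
    and "cylindrical_graph.has_rectangular_dual G arev rot outer"
  shows "PTC_graph G arev rot outer"
proof -
  interpret cylindrical_graph G arev rot outer by (rule assms(1))
  obtain t R lift where "rectangular_dual t R lift"
    using assms(2) unfolding has_rectangular_dual_def by (elim exE)
  then show ?thesis by (rule rectangular_dual_PTC)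
qed

end
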